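(* Let $n\ge 1$ be an integer, $0<p\le 1$, $0\le\rho\le 1$, $\lambda_s,\lambda_f\ge 0$, and let $f_0\neq f_1$ be probability density functions on $\mathbb{R}$. Consider the quickest detection problem with closed-loop control of the number of awake sensors, $$\min_{\tau,\,M_1,\dots,M_\tau}\ \mathsf{E}\Big[\lambda_f(1-\Pi_\tau)+\sum_{k=0}^{\tau-1}\big(\Pi_k+\lambda_s M_{k+1}\big)\Big],$$ where the minimum is over all admissible policies (stopping decisions and numbers $M_{k+1}\in\{0,1,\dots,n\}$ chosen as functions of the information $\mathbf{I}_k$) and $\Pi_k=\mathsf{P}\{T\le k\mid \mathbf{I}_k\}$. Then there is a constant $\Gamma\in[0,1]$, depending on the parameters of the problem (the false alarm cost $\lambda_f$, the distribution of $T$, the densities $f_0,f_1$, and $n,\lambda_s$), such that the optimal stopping rule is the threshold rule $$\tau^*=\inf\{k\ge 0:\ \Pi_k\ge\Gamma\},$$ i.e. there is an optimal policy whose stopping time is $\tau^*$.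
   Context: Model. The change time $T\in\{0,1,2,\dots\}$ has distribution $\mathsf{P}\{T=0\}=\rho$ and $\mathsf{P}\{T=k\}=(1-\rho)(1-p)^{k-1}p$ for $k\ge 1$. There are $n$ sensors. Given $T$, the potential observations $X_k^{(i)}$ ($k\ge1$, $1\le i\le n$) are independent across sensors and time, with density $f_0$ if $k<T$ and density $f_1$ if $k\ge T$. At each slot $k=0,1,2,\dots$ a fusion centre, based on the information $\mathbf{I}_k$ (all observations received in slots $1,\dots,k$ and all actions taken in slots $0,\dots,k-1$; $\mathbf{I}_0$ is trivial), takes an action $A_k$, a measurable function of $\mathbf{I}_k$: either stop and raise an alarm (action $(1,0)$), or continue with $m$ awake sensors (action $(0,m)$, $m\in\{0,1,\dots,n\}$). If it continues with $m=M_{k+1}$, then in slot $k+1$ it receives the observations $X_{k+1}^{(i)}$ of exactly $M_{k+1}$ sensors (which ones is immaterial, the observations being conditionally i.i.d. across sensors), and no others. The stopping time $\tau$ is the first $k$ at which the stop action is taken. An admissible policy is any such sequence of measurable decision functions. If $\tau=\infty$, the cost is $\sum_{k=0}^\infty(\Pi_k+\lambda_sM_{k+1})$. The a posteriori probability $\Pi_k=\mathsf{P}\{T\le k\mid\mathbf{I}_k\}$ satisfies $\Pi_0=\rho$ and, while continuing, $$\Pi_{k}=\frac{\widetilde\Pi_{k-1}\phi_1(\mathbf{Y}_{k})}{\widetilde\Pi_{k-1}\phi_1(\mathbf{Y}_{k})+(1-\widetilde\Pi_{k-1})\phi_0(\mathbf{Y}_{k})},\qquad \widetilde\Pi_{k-1}=\Pi_{k-1}+(1-\Pi_{k-1})p,$$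 where $\mathbf{Y}_k$ is the vector of observations received in slot $k$ and $\phi_j(\mathbf{y})=\prod_i f_j(y_i)$ (empty product equal to $1$). The number $\lambda_f$ is the cost of false alarm; in the constrained version of the problem with constraint $\mathsf{P}\{\tau<T\}\le\alpha$, it plays the role of a Lagrange multiplier chosen so that the constraint holds with equality, and the constraint level $\alpha$ enters only through $\lambda_f$. *)

theory Defs
  imports "HOL-Probability.Probability" "HOL-Library.Extended_Nat"
begin

definition prob_density_fun :: "(real \<Rightarrow> real) \<Rightarrow> bool" where
  "prob_density_fun f \<longleftrightarrow>
     f \<in> borel_measurable borel \<and> (\<forall>x. 0 \<le> f x) \<and> (\<integral>\<^sup>+x. ennreal (f x) \<partial>lborel) = 1"

text \<open>
  The change time is \<open>T\<close>; \<open>X k i\<close> is the potential observation of sensor \<open>i\<close> (\<open>1 \<le> i \<le> n\<close>) in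
  slot \<open>k \<ge> 1\<close>. The conditional law given \<open>T = t\<close> is the elementary one, for every value \<open>t\<close>
  that has positive probability.
\<close>

locale change_model = prob_space M
  for M :: "'a measure" and T :: "'a \<Rightarrow> nat" and X :: "nat \<Rightarrow> nat \<Rightarrow> 'a \<Rightarrow> real"
    and n :: nat and p \<rho> :: real and f0 f1 :: "real \<Rightarrow> real" +
  assumes T_measurable: "T \<in> M \<rightarrow>\<^sub>M count_space UNIV"
    and X_measurable: "\<And>k i. 1 \<le> k \<Longrightarrow> i \<in> {1..n} \<Longrightarrow> X k i \<in> borel_measurable M"
    and T_zero: "prob {\<omega> \<in> space M. T \<omega> = 0} = \<rho>"
    and T_pos: "\<And>k. 1 \<le> k \<Longrightarrow> prob {\<omega> \<in> space M. T \<omega> = k} = (1 - \<rho>) * (1 - p) ^ (k - 1) * p"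
    and X_indep: "\<And>t. 0 < prob {\<omega> \<in> space M. T \<omega> = t} \<Longrightarrow>
      prob_space.indep_vars (uniform_measure M {\<omega> \<in> space M. T \<omega> = t})
        (\<lambda>_. borel) (\<lambda>(k, i). X k i) ({1..} \<times> {1..n})"
    and X_distributed: "\<And>t k i. 0 < prob {\<omega> \<in> space M. T \<omega> = t} \<Longrightarrow> 1 \<le> k \<Longrightarrow> i \<in> {1..n} \<Longrightarrow>
      distributed (uniform_measure M {\<omega> \<in> space M. T \<omega> = t}) lborel (X k i)
        (\<lambda>x. ennreal (if k < t then f0 x else f1 x))"

datatype action = Stop | Continue (awake: nat)
  where "awake Stop = 0"

definition actions :: "nat \<Rightarrow> action set" where
  "actions n = insert Stop (Continue ` {0..n})"

text \<open>
  The information at slot \<open>k\<close> is a function on \<open>{..<k}\<close>; its entry at \<open>j\<close> consists of the action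
  taken in slot \<open>j\<close> and the vector of observations received in slot \<open>j + 1\<close>. With \<open>m\<close> sensors awake
  the received observations are those of the sensors \<open>1, \<dots>, m\<close>; the other coordinates are padded
  with \<open>0\<close>. The recorded action tells padding from data.
\<close>

type_synonym info = "nat \<Rightarrow> action \<times> (nat \<Rightarrow> real)"

type_synonym policy = "nat \<Rightarrow> info \<Rightarrow> action"

definition info_space :: "nat \<Rightarrow> nat \<Rightarrow> info measure" where
  "info_space n k = PiM {..<k} (\<lambda>_. count_space UNIV \<Otimes>\<^sub>M PiM {1..n} (\<lambda>_. borel))"

definition admissible :: "nat \<Rightarrow> policy \<Rightarrow> bool" where
  "admissible n \<mu> \<longleftrightarrow> (\<forall>k. \<mu> k \<in> info_space n k \<rightarrow>\<^sub>M count_space (actions n))"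

primrec info :: "nat \<Rightarrow> (nat \<Rightarrow> nat \<Rightarrow> 'a \<Rightarrow> real) \<Rightarrow> policy \<Rightarrow> nat \<Rightarrow> 'a \<Rightarrow> info" where
  "info n X \<mu> 0 \<omega> = (\<lambda>_. undefined)"
| "info n X \<mu> (Suc k) \<omega> =
     (let I = info n X \<mu> k \<omega>; A = \<mu> k I
      in I(k := (A, \<lambda>i\<in>{1..n}. if i \<le> awake A then X (Suc k) i \<omega> else 0)))"

definition action_taken :: "nat \<Rightarrow> (nat \<Rightarrow> nat \<Rightarrow> 'a \<Rightarrow> real) \<Rightarrow> policy \<Rightarrow> nat \<Rightarrow> 'a \<Rightarrow> action" where
  "action_taken n X \<mu> k \<omega> = \<mu> k (info n X \<mu> k \<omega>)"

definition info_algebra ::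
  "'a measure \<Rightarrow> nat \<Rightarrow> (nat \<Rightarrow> nat \<Rightarrow> 'a \<Rightarrow> real) \<Rightarrow> policy \<Rightarrow> nat \<Rightarrow> 'a measure" where
  "info_algebra M n X \<mu> k = vimage_algebra (space M) (info n X \<mu> k) (info_space n k)"

definition posterior :: "'a measure \<Rightarrow> ('a \<Rightarrow> nat) \<Rightarrow> nat \<Rightarrow> (nat \<Rightarrow> nat \<Rightarrow> 'a \<Rightarrow> real) \<Rightarrow> policy
    \<Rightarrow> nat \<Rightarrow> 'a \<Rightarrow> real" where
  "posterior M T n X \<mu> k =
     real_cond_exp M (info_algebra M n X \<mu> k) (indicator {\<omega> \<in> space M. T \<omega> \<le> k})"

text \<open>In \<^typ>\<open>enat\<close>, the infimum of the empty set is \<open>\<infinity>\<close>.\<close>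

definition stopping_slot :: "nat \<Rightarrow> (nat \<Rightarrow> nat \<Rightarrow> 'a \<Rightarrow> real) \<Rightarrow> policy \<Rightarrow> 'a \<Rightarrow> enat" where
  "stopping_slot n X \<mu> \<omega> = Inf {enat k | k. action_taken n X \<mu> k \<omega> = Stop}"

text \<open>
  All costs are almost surely nonnegative; the expected cost is formed in \<^typ>\<open>ennreal\<close>
  and may be infinite.
\<close>

definition running_cost :: "'a measure \<Rightarrow> ('a \<Rightarrow> nat) \<Rightarrow> nat \<Rightarrow> (nat \<Rightarrow> nat \<Rightarrow> 'a \<Rightarrow> real) \<Rightarrow> real
    \<Rightarrow> policy \<Rightarrow> nat \<Rightarrow> 'a \<Rightarrow> ennreal" where
  "running_cost M T n X lam_s \<mu> k \<omega> =
     ennreal (posterior M T n X \<mu> k \<omega> + lam_s * real (awake (action_taken n X \<mu> k \<omega>)))"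

definition path_cost :: "'a measure \<Rightarrow> ('a \<Rightarrow> nat) \<Rightarrow> nat \<Rightarrow> (nat \<Rightarrow> nat \<Rightarrow> 'a \<Rightarrow> real) \<Rightarrow> real
    \<Rightarrow> real \<Rightarrow> policy \<Rightarrow> 'a \<Rightarrow> ennreal" where
  "path_cost M T n X lam_s lam_f \<mu> \<omega> =
     (case stopping_slot n X \<mu> \<omega> of
        enat N \<Rightarrow> ennreal (lam_f * (1 - posterior M T n X \<mu> N \<omega>))
                    + (\<Sum>k<N. running_cost M T n X lam_s \<mu> k \<omega>)
      | \<infinity> \<Rightarrow> (\<Sum>k. running_cost M T n X lam_s \<mu> k \<omega>))"

definition expected_cost :: "'a measure \<Rightarrow> ('a \<Rightarrow> nat) \<Rightarrow> nat \<Rightarrow> (nat \<Rightarrow> nat \<Rightarrow> 'a \<Rightarrow> real) \<Rightarrow> real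
    \<Rightarrow> real \<Rightarrow> policy \<Rightarrow> ennreal" where
  "expected_cost M T n X lam_s lam_f \<mu> = (\<integral>\<^sup>+\<omega>. path_cost M T n X lam_s lam_f \<mu> \<omega> \<partial>M)"

end

theory Submission
  imports Defs
begin

text \<open>
  Instead of the posterior, the proof follows the unnormalised weights \<open>(a, b)\<close> of the events
  \<open>T \<le> k\<close> and \<open>T > k\<close>, i.e. their densities with respect to the model in which all observations
  have the law with density \<open>(f0 + f1) / 2\<close>. A slot maps \<open>(a, b)\<close> linearly to
  \<open>((a + p b) \<phi>1, (1 - p) b \<phi>0)\<close>, so the finite-horizon value functions \<open>V N a b\<close> are positively
  homogeneous and nondecreasing in \<open>a\<close>, and so is their limit \<open>W\<close>, which satisfies the Bellman
  equation. Stopping is optimal iff \<open>W a b = lam_f b\<close>; since \<open>W a b \<le> lam_f b\<close> always, homogeneity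
  and monotonicity in \<open>a\<close> make this set an up-set in \<open>a / (a + b)\<close> (no concavity is needed), and a
  Lipschitz bound in \<open>a\<close> makes it closed, which gives the threshold. Optimality follows by
  verification: the value left after \<open>N\<close> slots is at most \<open>lam_f P(T > N)\<close>, which vanishes under
  every policy.
\<close>

section \<open>Dynamic programming on unnormalised posterior weights\<close>

text \<open>The posterior recursion divides by the predictive density of the new observations, and
  the expectation in the Bellman equation is taken under that same density. Multiplying through by
  the total mass cancels the two and leaves integrals against one fixed law, so that degenerate
  posteriors and vanishing likelihoods need no exclusion. The threshold has to be the same for all
  realisations of the model; hence the optimisation is carried out from the densities and parameters
  alone, and only afterwards are the weights identified with the joint law of \<open>T\<close> and
  the information under a policy, one value of \<open>T\<close> at a time. Values lie in
  \<open>ennreal\<close>, so policies that never stop or have infinite cost stay in the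
  comparison.\<close>

text \<open>Multiplication by a positive finite \<open>c\<close> is an order isomorphism of
  \<open>ennreal\<close> with division by \<open>c\<close> as its inverse; this is why homogeneity
  is later stated for such \<open>c\<close>.\<close>

lemma INF_ennreal_cmult:
  fixes f :: "'i \<Rightarrow> ennreal"
  assumes c: "0 < c" "c < \<top>"
  shows "(INF i\<in>I. c * f i) = c * (INF i\<in>I. f i)"
proof (rule antisym)
  have cancel: "c * (x / c) = x" "c * x / c = x" for x
    using c by (auto simp: ennreal_times_divide mult.commute[of c] ennreal_mult_divide_eq)
  have "(INF i\<in>I. c * f i) / c \<le> (INF i\<in>I. f i)"
  proof (rule INF_greatest)
    fix i assume "i \<in> I"
    then have "(INF i\<in>I. c * f i) / c \<le> c * f i / c"
      by (intro divide_right_mono_ennreal INF_lower)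
    then show "(INF i\<in>I. c * f i) / c \<le> f i" by (simp add: cancel)
  qed
  then have "c * ((INF i\<in>I. c * f i) / c) \<le> c * (INF i\<in>I. f i)"
    by (rule mult_left_mono) simp
  then show "(INF i\<in>I. c * f i) \<le> c * (INF i\<in>I. f i)" by (simp only: cancel)
qed (auto intro!: INF_greatest mult_left_mono INF_lower)

lemma INF_ennreal_add:
  fixes f :: "'i \<Rightarrow> ennreal"
  assumes "I \<noteq> {}"
  shows "(INF i\<in>I. f i + c) = (INF i\<in>I. f i) + c"
  using continuous_at_Inf_mono[of "\<lambda>x. x + c" "f ` I"]
  using continuous_add[of "at_right (Inf (f ` I))", of "\<lambda>x. x" "\<lambda>x. c"] assms
  by (auto simp: mono_def image_comp)

lemma ennreal_min_le_add:
  fixes x y y' c :: ennreal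
  assumes "y' \<le> y + c"
  shows "min x y' \<le> min x y + c"
proof (cases "x \<le> y")
  case True
  then show ?thesis by (simp add: min.coboundedI1 add_increasing2)
next
  case False
  then show ?thesis using assms by (simp add: min.coboundedI2 min.absorb2)
qed

locale detection = prob_space L
  for L :: "real measure" +
  fixes n :: nat and p rho lam_s lam_f :: real and r0 r1 :: "real \<Rightarrow> ennreal"
  assumes p: "0 < p" "p \<le> 1"
    and rho: "0 \<le> rho" "rho \<le> 1"
    and lam: "0 \<le> lam_s" "0 \<le> lam_f"
    and sets_L [measurable_cong]: "sets L = sets borel"
    and r0_measurable [measurable]: "r0 \<in> borel_measurable borel"
    and r1_measurable [measurable]: "r1 \<in> borel_measurable borel"
    and r_finite: "r0 x < \<top>" "r1 x < \<top>"
    and r_int: "(\<integral>\<^sup>+x. r0 x \<partial>L) = 1" "(\<integral>\<^sup>+x. r1 x \<partial>L) = 1"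
begin

definition R :: "(nat \<Rightarrow> real) measure" where
  "R = PiM {1..n} (\<lambda>_. L)"

text \<open>Sleeping sensors contribute a factor 1 instead of being removed, so every choice of
  \<open>m\<close> is integrated against the same \<open>R\<close>.\<close>

definition lik :: "(real \<Rightarrow> ennreal) \<Rightarrow> nat \<Rightarrow> (nat \<Rightarrow> real) \<Rightarrow> ennreal" where
  "lik r m y = (\<Prod>i\<in>{1..n}. if i \<le> m then r (y i) else 1)"

text \<open>The Bellman expression at posterior \<open>a / (a + b)\<close>, multiplied by the mass
  \<open>a + b\<close>: the delay cost becomes \<open>a\<close>, and the arguments of
  \<open>U\<close> are the weights after one slot.\<close>

definition continuation ::
  "(ennreal \<Rightarrow> ennreal \<Rightarrow> ennreal) \<Rightarrow> nat \<Rightarrow> ennreal \<Rightarrow> ennreal \<Rightarrow> ennreal" where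
  "continuation U m a b = a + ennreal lam_s * of_nat m * (a + b)
     + (\<integral>\<^sup>+y. U ((a + ennreal p * b) * lik r1 m y) (ennreal (1 - p) * b * lik r0 m y) \<partial>R)"

definition bellman :: "(ennreal \<Rightarrow> ennreal \<Rightarrow> ennreal) \<Rightarrow> ennreal \<Rightarrow> ennreal \<Rightarrow> ennreal" where
  "bellman U a b = min (ennreal lam_f * b) (INF m\<in>{0..n}. continuation U m a b)"

text \<open>With no slot left only the alarm remains, at cost \<open>lam_f * b\<close>. Starting
  from an option that is always available makes the iterates decrease in \<open>N\<close>.\<close>

primrec V :: "nat \<Rightarrow> ennreal \<Rightarrow> ennreal \<Rightarrow> ennreal" where
  "V 0 = (\<lambda>a b. ennreal lam_f * b)"
| "V (Suc N) = bellman (V N)"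

definition W :: "ennreal \<Rightarrow> ennreal \<Rightarrow> ennreal" where
  "W a b = (INF N. V N a b)"

lemma prob_space_R: "prob_space R"
  unfolding R_def by (intro prob_space_PiM prob_space_axioms)

lemma sets_R [measurable_cong]: "sets R = sets (PiM {1..n} (\<lambda>_. borel))"
  unfolding R_def by (intro sets_PiM_cong refl sets_L)

lemma sigma_finite_R: "sigma_finite_measure R"
  using prob_space_R by (simp add: prob_space_imp_sigma_finite)

lemma lik_measurable [measurable]:
  assumes [measurable]: "r \<in> borel_measurable borel"
  shows "lik r m \<in> borel_measurable (PiM {1..n} (\<lambda>_. borel))"
  unfolding lik_def by measurable

lemma lik_finite: "(\<And>x. r x < \<top>) \<Longrightarrow> lik r m y < \<top>"
  unfolding lik_def by (simp add: less_top[symmetric] ennreal_prod_eq_top)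

lemma lik_integral:
  assumes [measurable]: "r \<in> borel_measurable borel" and "(\<integral>\<^sup>+x. r x \<partial>L) = 1"
  shows "(\<integral>\<^sup>+y. lik r m y \<partial>R) = 1"
proof -
  have L1: "emeasure L (space L) = 1" by (rule emeasure_space_1)
  interpret product_prob_space "\<lambda>_::nat. L"
    by (intro product_prob_spaceI prob_space_axioms)
  have "(\<integral>\<^sup>+y. lik r m y \<partial>R)
      = (\<integral>\<^sup>+y. (\<Prod>i\<in>{1..n}. (\<lambda>x. if i \<le> m then r x else 1) (y i)) \<partial>R)"
    unfolding lik_def by simp
  also have "\<dots> = (\<Prod>i\<in>{1..n}. \<integral>\<^sup>+x. (if i \<le> m then r x else 1) \<partial>L)"
    unfolding R_def by (rule product_nn_integral_prod) auto
  also have "\<dots> = 1"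
  proof (intro prod.neutral ballI)
    fix i :: nat
    show "(\<integral>\<^sup>+x. (if i \<le> m then r x else 1) \<partial>L) = 1"
      using assms(2) by (cases "i \<le> m") (simp_all add: L1)
  qed
  finally show ?thesis .
qed

lemma bellman_mono:
  assumes "\<And>a b. U a b \<le> U' a b"
  shows "bellman U a b \<le> bellman U' a b"
  unfolding bellman_def continuation_def
  by (intro min.mono INF_mono' add_mono nn_integral_mono assms order_refl)

lemma V_decseq: "V (Suc N) a b \<le> V N a b"
proof (induction N arbitrary: a b)
  case 0
  then show ?case by (simp add: bellman_def)
next
  case (Suc N)
  then show ?case using bellman_mono[of "V (Suc N)" "V N"] by simp
qed

lemma V_mono: "a \<le> a' \<Longrightarrow> b \<le> b' \<Longrightarrow> V N a b \<le> V N a' b'"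
proof (induction N arbitrary: a b a' b')
  case 0
  then show ?case by (simp add: mult_left_mono)
next
  case (Suc N)
  then show ?case
    unfolding V.simps bellman_def continuation_def
    by (intro min.mono INF_mono' add_mono nn_integral_mono Suc.IH mult_mono) auto
qed

lemma V_measurable [measurable]: "(\<lambda>(a, b). V N a b) \<in> borel_measurable (borel \<Otimes>\<^sub>M borel)"
proof (induction N)
  case 0
  then show ?case by simp
next
  case (Suc N)
  interpret R: sigma_finite_measure R by (rule sigma_finite_R)
  note Suc [measurable]
  show ?case
    unfolding V.simps bellman_def continuation_def by measurable
qed

lemma W_measurable [measurable]: "(\<lambda>(a, b). W a b) \<in> borel_measurable (borel \<Otimes>\<^sub>M borel)"
  unfolding W_def by measurable

lemma V_homogeneous:
  assumes c: "0 < c" "c < \<top>"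
  shows "V N (c * a) (c * b) = c * V N a b"
proof (induction N arbitrary: a b)
  case 0
  then show ?case by (simp add: ac_simps)
next
  case (Suc N)
  have "continuation (V N) m (c * a) (c * b) = c * continuation (V N) m a b" for m
  proof -
    have "V N ((c * a + ennreal p * (c * b)) * lik r1 m y) (ennreal (1 - p) * (c * b) * lik r0 m y)
        = c * V N ((a + ennreal p * b) * lik r1 m y) (ennreal (1 - p) * b * lik r0 m y)" for y
      by (subst Suc[symmetric]) (simp add: algebra_simps)
    then have "(\<integral>\<^sup>+y. V N ((c * a + ennreal p * (c * b)) * lik r1 m y) (ennreal (1 - p) * (c * b) * lik r0 m y) \<partial>R)
      = c * (\<integral>\<^sup>+y. V N ((a + ennreal p * b) * lik r1 m y) (ennreal (1 - p) * b * lik r0 m y) \<partial>R)"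
      by (simp add: nn_integral_cmult)
    then show ?thesis
      by (simp add: continuation_def distrib_left mult.left_commute)
  qed
  moreover have "min (c * x) (c * y) = c * min x y" for x y :: ennreal
    by (intro min_of_mono monoI mult_left_mono) auto
  ultimately show ?case
    by (simp add: bellman_def mult.left_commute INF_ennreal_cmult[OF c])
qed

text \<open>A unit of \<open>a\<close> adds 1 through the delay cost, at most
  \<open>lam_s * n\<close> through the sensor cost, and the previous constant undiminished, since
  \<open>lik r1 m\<close> integrates to 1. The constants are finite but grow without bound in
  \<open>N\<close>.\<close>

primrec lipschitz_const :: "nat \<Rightarrow> ennreal" where
  "lipschitz_const 0 = 0"
| "lipschitz_const (Suc N) = 1 + ennreal lam_s * of_nat n + lipschitz_const N"

lemma lipschitz_const_finite: "lipschitz_const N < \<top>"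
  by (induction N) (auto simp: ennreal_mult_less_top of_nat_less_top)

lemma V_add_le: "V N (a + h) b \<le> V N a b + lipschitz_const N * h"
proof (induction N arbitrary: a b h)
  case 0
  then show ?case by simp
next
  case (Suc N)
  have "continuation (V N) m (a + h) b \<le> continuation (V N) m a b + lipschitz_const (Suc N) * h"
    if "m \<le> n" for m
  proof -
    have "(\<integral>\<^sup>+y. V N ((a + h + ennreal p * b) * lik r1 m y) (ennreal (1 - p) * b * lik r0 m y) \<partial>R)
      \<le> (\<integral>\<^sup>+y. V N ((a + ennreal p * b) * lik r1 m y) (ennreal (1 - p) * b * lik r0 m y)
            + lipschitz_const N * h * lik r1 m y \<partial>R)"
    proof (rule nn_integral_mono)
      fix y
      have "(a + h + ennreal p * b) * lik r1 m y = (a + ennreal p * b) * lik r1 m y + h * lik r1 m y"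
        by (simp add: distrib_right add_ac)
      then show "V N ((a + h + ennreal p * b) * lik r1 m y) (ennreal (1 - p) * b * lik r0 m y)
        \<le> V N ((a + ennreal p * b) * lik r1 m y) (ennreal (1 - p) * b * lik r0 m y)
            + lipschitz_const N * h * lik r1 m y"
        using Suc.IH[of "(a + ennreal p * b) * lik r1 m y" "h * lik r1 m y"]
        by (simp add: mult.assoc)
    qed
    also have "\<dots> = (\<integral>\<^sup>+y. V N ((a + ennreal p * b) * lik r1 m y) (ennreal (1 - p) * b * lik r0 m y) \<partial>R)
            + lipschitz_const N * h"
      by (simp add: nn_integral_add nn_integral_cmult lik_integral r_int)
    finally have *: "(\<integral>\<^sup>+y. V N ((a + h + ennreal p * b) * lik r1 m y) (ennreal (1 - p) * b * lik r0 m y) \<partial>R)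
      \<le> \<dots>" .
    have **: "ennreal lam_s * of_nat m * h \<le> ennreal lam_s * of_nat n * h"
      using that by (intro mult_mono) auto
    have "continuation (V N) m (a + h) b
      \<le> a + h + (ennreal lam_s * of_nat m * (a + b) + ennreal lam_s * of_nat n * h)
        + ((\<integral>\<^sup>+y. V N ((a + ennreal p * b) * lik r1 m y) (ennreal (1 - p) * b * lik r0 m y) \<partial>R)
            + lipschitz_const N * h)"
      unfolding continuation_def
      using ** by (intro add_mono order_refl *) (simp add: distrib_left add_mono)
    also have "\<dots> = continuation (V N) m a b + lipschitz_const (Suc N) * h"
      by (simp add: continuation_def distrib_right add_ac)
    finally show ?thesis .
  qed
  then have "(INF m\<in>{0..n}. continuation (V N) m (a + h) b)
      \<le> (INF m\<in>{0..n}. continuation (V N) m a b + lipschitz_const (Suc N) * h)"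
    by (intro INF_superset_mono) (auto simp del: lipschitz_const.simps)
  also have "\<dots> = (INF m\<in>{0..n}. continuation (V N) m a b) + lipschitz_const (Suc N) * h"
    by (rule INF_ennreal_add) simp
  finally show ?case
    unfolding V.simps bellman_def by (rule ennreal_min_le_add)
qed

section \<open>Infinite-horizon value function\<close>

lemma W_le: "W a b \<le> ennreal lam_f * b"
  unfolding W_def by (rule INF_lower2[of 0]) simp_all

lemma W_homogeneous: "0 < c \<Longrightarrow> c < \<top> \<Longrightarrow> W (c * a) (c * b) = c * W a b"
  unfolding W_def by (simp add: V_homogeneous INF_ennreal_cmult)

text \<open>Decreasing limits pass through an integral once one member has a finite integral; for
  \<open>V 0\<close> it is \<open>lam_f * (1 - p) * b\<close>, whence the condition on
  \<open>b\<close>.\<close>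

lemma continuation_W:
  assumes b: "b < \<top>"
  shows "continuation W m a b = (INF N. continuation (V N) m a b)"
proof -
  have "(\<integral>\<^sup>+y. V 0 ((a + ennreal p * b) * lik r1 m y) (ennreal (1 - p) * b * lik r0 m y) \<partial>R)
      = ennreal lam_f * (ennreal (1 - p) * b)"
    by (simp add: nn_integral_cmult lik_integral r_int)
  then have "(\<integral>\<^sup>+y. W ((a + ennreal p * b) * lik r1 m y) (ennreal (1 - p) * b * lik r0 m y) \<partial>R)
      = (INF N. \<integral>\<^sup>+y. V N ((a + ennreal p * b) * lik r1 m y) (ennreal (1 - p) * b * lik r0 m y) \<partial>R)"
    unfolding W_def using b
    by (intro nn_integral_monotone_convergence_INF_AE' AE_I2 V_decseq)
      (simp_all add: ennreal_mult_less_top del: V.simps)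
  then show ?thesis
    unfolding continuation_def by (simp add: INF_ennreal_const_add)
qed

text \<open>The limit over horizons, the choice of \<open>m\<close> and the choice between alarm and
  continuation are all infima, so they commute.\<close>

lemma W_fixed_point:
  assumes "b < \<top>"
  shows "W a b = bellman W a b"
proof -
  have "W a b = (INF N. V (Suc N) a b)"
    unfolding W_def
  proof (rule antisym)
    show "(INF N. V N a b) \<le> (INF N. V (Suc N) a b)"
      by (intro INF_greatest INF_lower[where f = "\<lambda>N. V N a b"] UNIV_I)
    show "(INF N. V (Suc N) a b) \<le> (INF N. V N a b)"
      by (rule INF_mono') (rule V_decseq)
  qed
  also have "\<dots> = (INF N. inf (ennreal lam_f * b) (INF m\<in>{0..n}. continuation (V N) m a b))"
    by (simp add: bellman_def inf_min)
  also have "\<dots> = inf (ennreal lam_f * b) (INF N. INF m\<in>{0..n}. continuation (V N) m a b)"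
    by (subst INF_inf_distrib[symmetric]) simp
  also have "(INF N. INF m\<in>{0..n}. continuation (V N) m a b) = (INF m\<in>{0..n}. continuation W m a b)"
    unfolding continuation_W[OF assms] by (rule INF_commute)
  finally show ?thesis by (simp add: bellman_def inf_min)
qed

section \<open>The stopping set\<close>

definition stop_set :: "real set" where
  "stop_set = {x \<in> {0..1}. ennreal (lam_f * (1 - x)) \<le> W (ennreal x) (ennreal (1 - x))}"

definition threshold :: real where
  "threshold = Inf stop_set"

lemma W_mono: "a \<le> a' \<Longrightarrow> b \<le> b' \<Longrightarrow> W a b \<le> W a' b'"
  unfolding W_def by (intro INF_mono' V_mono)

lemma stop_set_1: "1 \<in> stop_set"
  by (simp add: stop_set_def)

lemma stop_set_upward:
  assumes x: "x \<in> stop_set" and le: "x \<le> x'" "x' \<le> 1"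
  shows "x' \<in> stop_set"
proof (cases "x' = 1")
  case False
  \<comment> \<open>Scaling by \<open>c\<close> turns the second weight \<open>1 - x\<close> into
    exactly \<open>1 - x'\<close>, while the first weight \<open>c * x\<close> does not exceed
    \<open>x'\<close>. For \<open>x' = 1\<close> the factor would be 0 and homogeneity would not
    apply.\<close>
  define c where "c = (1 - x') / (1 - x)"
  have x01: "0 \<le> x" "x < 1" using x le False by (auto simp: stop_set_def)
  have c: "0 < c" "c \<le> 1" "c * (1 - x) = 1 - x'"
    using x01 le False by (auto simp: c_def field_simps)
  have cx: "c * x \<le> x'"
    using c x01 le by (meson mult_left_le_one_le order.trans less_imp_le)
  have "ennreal (lam_f * (1 - x')) = ennreal c * ennreal (lam_f * (1 - x))"
    using c lam x01 by (simp add: ennreal_mult[symmetric] mult.left_commute flip: c(3))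
  also have "\<dots> \<le> ennreal c * W (ennreal x) (ennreal (1 - x))"
    using x by (intro mult_left_mono) (auto simp: stop_set_def)
  also have "\<dots> = W (ennreal c * ennreal x) (ennreal c * ennreal (1 - x))"
    using c by (intro W_homogeneous[symmetric]) auto
  also have "\<dots> \<le> W (ennreal x') (ennreal (1 - x'))"
    using c cx x01 by (intro W_mono) (simp_all add: ennreal_mult[symmetric] ennreal_leI)
  finally show ?thesis using x01 le by (auto simp: stop_set_def)
qed (simp add: stop_set_1)

lemma stop_set_bounds: "bdd_below stop_set" "stop_set \<noteq> {}"
  using stop_set_1 by (auto simp: stop_set_def intro!: bdd_belowI[of _ 0])

lemma threshold_bounds: "0 \<le> threshold" "threshold \<le> 1"
  unfolding threshold_def using stop_set_bounds
  by (auto intro!: cInf_greatest cInf_lower stop_set_1) (auto simp: stop_set_def)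

text \<open>The rule must stop also when the posterior equals the threshold, so the infimum has to
  be attained. Membership means that \<open>V N\<close> reaches the alarm cost for every
  \<open>N\<close>; each of these conditions is closed by the Lipschitz bound for that
  \<open>N\<close>, although no bound uniform in \<open>N\<close> is at hand.\<close>

lemma threshold_in_stop_set: "threshold \<in> stop_set"
proof -
  let ?G = threshold
  have "ennreal (lam_f * (1 - ?G)) \<le> V N (ennreal ?G) (ennreal (1 - ?G))" for N
  proof (rule ennreal_le_epsilon)
    fix e :: real assume e: "0 < e"
    obtain d where d: "0 \<le> d" "lipschitz_const N = ennreal d"
      using lipschitz_const_finite[of N] by (metis ennreal_cases less_top)
    \<comment> \<open>Moving from \<open>x\<close> to the threshold changes \<open>V N\<close> by at
      most \<open>d * (x - threshold)\<close> and the alarm cost by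
      \<open>lam_f * (x - threshold)\<close>; the summand 1 keeps the denominator positive.\<close>
    define \<delta> where "\<delta> = e / (d + lam_f + 1)"
    have \<delta>: "0 < \<delta>" "(d + lam_f) * \<delta> \<le> e"
      using e d lam by (auto simp: \<delta>_def field_simps)
    obtain x where x: "x \<in> stop_set" "x < ?G + \<delta>"
      using cInf_lessD[OF stop_set_bounds(2), of "?G + \<delta>"] \<delta> by (auto simp: threshold_def)
    have Gx: "?G \<le> x" unfolding threshold_def by (intro cInf_lower x stop_set_bounds)
    have x01: "0 \<le> x" "x \<le> 1" using x by (auto simp: stop_set_def)
    have "ennreal (lam_f * (1 - ?G)) = ennreal (lam_f * (1 - x)) + ennreal (lam_f * (x - ?G))"
      using lam x01 Gx by (subst ennreal_plus[symmetric]) (auto simp: algebra_simps mult_left_mono mult_left_le)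
    also have "ennreal (lam_f * (1 - x)) \<le> V N (ennreal x) (ennreal (1 - x))"
      using x by (auto simp: stop_set_def W_def intro: order_trans INF_lower)
    also have "\<dots> \<le> V N (ennreal ?G + ennreal (x - ?G)) (ennreal (1 - ?G))"
      using Gx x01 threshold_bounds by (intro V_mono) (auto simp: ennreal_plus[symmetric] simp del: ennreal_plus)
    also have "\<dots> \<le> V N (ennreal ?G) (ennreal (1 - ?G)) + ennreal d * ennreal (x - ?G)"
      using V_add_le d by metis
    also have "V N (ennreal ?G) (ennreal (1 - ?G)) + ennreal d * ennreal (x - ?G) + ennreal (lam_f * (x - ?G))
      = V N (ennreal ?G) (ennreal (1 - ?G)) + ennreal ((d + lam_f) * (x - ?G))"
      using d lam Gx by (simp add: ennreal_mult[symmetric] ennreal_plus[symmetric] add.assoc distrib_right del: ennreal_plus)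
    also have "ennreal ((d + lam_f) * (x - ?G)) \<le> ennreal e"
    proof (rule ennreal_leI)
      have "(d + lam_f) * (x - ?G) \<le> (d + lam_f) * \<delta>"
        using x d lam by (intro mult_left_mono) auto
      then show "(d + lam_f) * (x - ?G) \<le> e" using \<delta> by simp
    qed
    finally show "ennreal (lam_f * (1 - ?G)) \<le> V N (ennreal ?G) (ennreal (1 - ?G)) + ennreal e"
      by (simp add: add_mono add_left_mono)
  qed
  then show ?thesis
    using threshold_bounds by (auto simp: stop_set_def W_def intro!: INF_greatest)
qed

lemma stop_set_eq: "stop_set = {threshold..1}"
proof
  show "stop_set \<subseteq> {threshold..1}"
  proof
    fix x assume x: "x \<in> stop_set"
    then have "threshold \<le> x"
      unfolding threshold_def by (intro cInf_lower stop_set_bounds)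
    with x show "x \<in> {threshold..1}" by (simp add: stop_set_def)
  qed
  show "{threshold..1} \<subseteq> stop_set"
    using stop_set_upward[OF threshold_in_stop_set] by auto
qed

text \<open>Scaling to total mass 1 reduces arbitrary weights to \<open>stop_set\<close>. When both
  weights vanish the quotient is 0 by convention, and alarm cost, continuation cost and
  \<open>W\<close> are all 0, so both claims hold wherever the threshold lies.\<close>

lemma W_eq_stop_or_continue:
  assumes fin: "a < \<top>" "b < \<top>"
  shows "threshold \<le> enn2real (a / (a + b)) \<Longrightarrow> W a b = ennreal lam_f * b"
    and "enn2real (a / (a + b)) < threshold \<Longrightarrow> W a b = (INF m\<in>{0..n}. continuation W m a b)"
proof -
  have "(threshold \<le> enn2real (a / (a + b)) \<longrightarrow> W a b = ennreal lam_f * b) \<and>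
    (enn2real (a / (a + b)) < threshold \<longrightarrow> W a b = (INF m\<in>{0..n}. continuation W m a b))"
  proof (cases "a + b = 0")
    case True
    then have [simp]: "a = 0" "b = 0" by auto
    have [simp]: "W 0 0 = 0" using W_le[of 0 0] by simp
    show ?thesis by (simp add: continuation_def)
  next
    case False
    obtain x y where xy: "a = ennreal x" "b = ennreal y" "0 \<le> x" "0 \<le> y"
      using fin by (metis ennreal_cases less_top)
    define s where "s = x + y"
    define z where "z = x / s"
    have s: "0 < s" using False xy by (auto simp: s_def)
    have z: "enn2real (a / (a + b)) = z"
      using xy s by (simp add: z_def s_def divide_ennreal flip: ennreal_plus)
    have z01: "0 \<le> z" "z \<le> 1" using xy s by (auto simp: z_def s_def)
    have ab: "a = ennreal s * ennreal z" "b = ennreal s * ennreal (1 - z)"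
      using xy s z01 by (simp_all add: ennreal_mult[symmetric]) (simp_all add: z_def s_def field_simps)
    have "W a b = ennreal s * W (ennreal z) (ennreal (1 - z))"
      unfolding ab using s by (intro W_homogeneous) auto
    moreover have "ennreal lam_f * b = ennreal s * ennreal (lam_f * (1 - z))"
      using lam s z01 by (simp add: ab ennreal_mult[symmetric] mult.left_commute)
    ultimately have *: "ennreal lam_f * b \<le> W a b \<longleftrightarrow> z \<in> stop_set"
      using s z01 by (auto simp: stop_set_def ennreal_mult_le_mult_iff)
    show ?thesis
    proof (intro conjI impI)
      assume "threshold \<le> enn2real (a / (a + b))"
      then have "z \<in> stop_set" using z z01 by (simp add: stop_set_eq)
      then show "W a b = ennreal lam_f * b" using * W_le by (simp add: antisym)
    next
      assume "enn2real (a / (a + b)) < threshold"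
      then have "\<not> ennreal lam_f * b \<le> W a b" using * z by (simp add: stop_set_eq)
      then show "W a b = (INF m\<in>{0..n}. continuation W m a b)"
        using W_fixed_point[OF fin(2), of a] by (auto simp: bellman_def min_def split: if_splits)
    qed
  qed
  then show "threshold \<le> enn2real (a / (a + b)) \<Longrightarrow> W a b = ennreal lam_f * b"
    and "enn2real (a / (a + b)) < threshold \<Longrightarrow> W a b = (INF m\<in>{0..n}. continuation W m a b)"
    by auto
qed

end

section \<open>Filter and threshold policy\<close>

lemma awake_measurable [measurable]: "awake \<in> count_space UNIV \<rightarrow>\<^sub>M count_space UNIV"
  by simp

definition received :: "nat \<Rightarrow> action \<Rightarrow> (nat \<Rightarrow> real) \<Rightarrow> nat \<Rightarrow> real" where
  "received n A y = (\<lambda>i\<in>{1..n}. if i \<le> awake A then y i else 0)"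

lemma admissible_measurable:
  assumes "admissible n \<mu>"
  shows "\<mu> k \<in> info_space n k \<rightarrow>\<^sub>M count_space UNIV"
  using measurable_compose[of "\<mu> k" "info_space n k" "count_space (actions n)" "\<lambda>x. x" "count_space UNIV"] assms
  by (simp add: admissible_def)

lemma admissible_range:
  assumes "admissible n \<mu>" "I \<in> space (info_space n k)"
  shows "\<mu> k I \<in> actions n"
  using measurable_space[of "\<mu> k" "info_space n k" "count_space (actions n)"] assms
  by (simp add: admissible_def)

lemma received_measurable:
  assumes [measurable]: "A \<in> N \<rightarrow>\<^sub>M count_space UNIV"
    and Y: "\<And>i. i \<in> {1..n} \<Longrightarrow> (\<lambda>x. Y x i) \<in> borel_measurable N"
  shows "(\<lambda>x. received n (A x) (Y x)) \<in> N \<rightarrow>\<^sub>M PiM {1..n} (\<lambda>_. borel)"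
  unfolding received_def
proof (rule measurable_restrict)
  fix i assume i: "i \<in> {1..n}"
  note Y[OF i, measurable]
  show "(\<lambda>x. if i \<le> awake (A x) then Y x i else 0) \<in> borel_measurable N"
    by measurable
qed

lemma info_extend_measurable:
  assumes "F \<in> N \<rightarrow>\<^sub>M info_space n k" "A \<in> N \<rightarrow>\<^sub>M count_space UNIV"
    and Y: "\<And>i. i \<in> {1..n} \<Longrightarrow> (\<lambda>x. Y x i) \<in> borel_measurable N"
  shows "(\<lambda>x. (F x)(k := (A x, received n (A x) (Y x)))) \<in> N \<rightarrow>\<^sub>M info_space n (Suc k)"
  using assms(1,2) received_measurable[OF assms(2) Y] unfolding info_space_def
  by (intro measurable_fun_upd[where J="{..<k}"] measurable_Pair) auto

text \<open>Picking the least minimiser makes the number of awake sensors a measurable selection, as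
  admissibility demands.\<close>

lemma measurable_least_minimizer:
  fixes f :: "nat \<Rightarrow> 'x \<Rightarrow> ennreal"
  assumes [measurable]: "\<And>m. f m \<in> borel_measurable N"
  shows "(\<lambda>x. LEAST m. m \<le> n \<and> (\<forall>m'\<le>n. f m x \<le> f m' x)) \<in> N \<rightarrow>\<^sub>M count_space UNIV"
proof (rule measurable_Least)
  fix m
  have "Measurable.pred N (\<lambda>x. m \<le> n \<and> (\<forall>m'\<in>{..n}. f m x \<le> f m' x))"
    by measurable
  then show "(\<lambda>x. m \<le> n \<and> (\<forall>m'\<le>n. f m x \<le> f m' x)) \<in> N \<rightarrow>\<^sub>M count_space UNIV"
    by (simp add: Ball_def)
qed

context detection
begin

text \<open>
  \<open>joint1 k\<close> and \<open>joint0 k\<close> are the unnormalised posterior weights of \<open>T \<le> k\<close> and \<open>T > k\<close>: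
  densities of the information with respect to the situation in which every received
  observation has the law \<open>L\<close>.
\<close>

primrec joint0 :: "nat \<Rightarrow> info \<Rightarrow> ennreal" where
  "joint0 0 I = ennreal (1 - rho)"
| "joint0 (Suc k) I = ennreal (1 - p) * joint0 k I * lik r0 (awake (fst (I k))) (snd (I k))"

primrec joint1 :: "nat \<Rightarrow> info \<Rightarrow> ennreal" where
  "joint1 0 I = ennreal rho"
| "joint1 (Suc k) I =
    (joint1 k I + ennreal p * joint0 k I) * lik r1 (awake (fst (I k))) (snd (I k))"

definition filter_prob :: "nat \<Rightarrow> info \<Rightarrow> real" where
  "filter_prob k I = enn2real (joint1 k I / (joint1 k I + joint0 k I))"

text \<open>Expectation of a function of the information when all observations have law
  \<open>L\<close>. The iterated form applies the policy between the integrations, so no product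
  space over all slots has to be built.\<close>

primrec ref_integral :: "policy \<Rightarrow> nat \<Rightarrow> (info \<Rightarrow> ennreal) \<Rightarrow> ennreal" where
  "ref_integral \<mu> 0 g = g (\<lambda>_. undefined)"
| "ref_integral \<mu> (Suc k) g =
    ref_integral \<mu> k (\<lambda>I. \<integral>\<^sup>+y. g (I(k := (\<mu> k I, received n (\<mu> k I) y))) \<partial>R)"

definition alive :: "nat \<Rightarrow> info \<Rightarrow> bool" where
  "alive k I \<longleftrightarrow> (\<forall>j<k. fst (I j) \<noteq> Stop)"

text \<open>Cost of one slot times the density of the information: the posterior and its complement
  are absorbed into \<open>joint1\<close> and \<open>joint0\<close>.\<close>

definition stage_cost :: "policy \<Rightarrow> nat \<Rightarrow> info \<Rightarrow> ennreal" where
  "stage_cost \<mu> k I =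
    (if \<not> alive k I then 0
     else if \<mu> k I = Stop then ennreal lam_f * joint0 k I
     else joint1 k I + ennreal lam_s * of_nat (awake (\<mu> k I)) * (joint1 k I + joint0 k I))"

definition value_alive :: "nat \<Rightarrow> info \<Rightarrow> ennreal" where
  "value_alive k I = (if alive k I then W (joint1 k I) (joint0 k I) else 0)"

definition best_awake :: "ennreal \<Rightarrow> ennreal \<Rightarrow> nat" where
  "best_awake a b =
    (LEAST m. m \<le> n \<and> (\<forall>m'\<le>n. continuation W m a b \<le> continuation W m' a b))"

text \<open>The comparison is made in every slot, even after an earlier alarm. Later decisions
  affect neither the cost nor the first alarm, and the set of alarm slots is then exactly the set
  where the threshold is reached.\<close>

definition threshold_policy :: policy where
  "threshold_policy k I =
    (if threshold \<le> filter_prob k I then Stop else Continue (best_awake (joint1 k I) (joint0 k I)))"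

lemma lik_received: "lik r (awake A) (received n A y) = lik r (awake A) y"
  unfolding lik_def received_def by (intro prod.cong) auto

lemma joint_finite: "joint0 k I < \<top>" "joint1 k I < \<top>"
proof -
  show *: "joint0 k I < \<top>" for k
    by (induction k) (auto simp: ennreal_mult_less_top lik_finite r_finite)
  show "joint1 k I < \<top>"
    using * by (induction k) (auto simp: ennreal_mult_less_top lik_finite r_finite)
qed

lemma joint_upd_ge: "k \<le> j \<Longrightarrow> joint0 k (I(j := z)) = joint0 k I"
  "k \<le> j \<Longrightarrow> joint1 k (I(j := z)) = joint1 k I"
proof -
  show *: "k \<le> j \<Longrightarrow> joint0 k (I(j := z)) = joint0 k I" for k
    by (induction k) auto
  show "k \<le> j \<Longrightarrow> joint1 k (I(j := z)) = joint1 k I"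
    using * by (induction k) auto
qed

lemma alive_upd: "alive (Suc k) (I(k := z)) \<longleftrightarrow> alive k I \<and> fst z \<noteq> Stop"
  by (auto simp: alive_def less_Suc_eq)

lemma joint_extend:
  "joint0 (Suc k) (I(k := (A, received n A y))) = ennreal (1 - p) * joint0 k I * lik r0 (awake A) y"
  "joint1 (Suc k) (I(k := (A, received n A y)))
     = (joint1 k I + ennreal p * joint0 k I) * lik r1 (awake A) y"
  by (simp_all add: joint_upd_ge lik_received)

lemma info_component_measurable [measurable]:
  assumes "j < k"
  shows "(\<lambda>I. fst (I j)) \<in> info_space n k \<rightarrow>\<^sub>M count_space UNIV"
    and "(\<lambda>I. snd (I j)) \<in> info_space n k \<rightarrow>\<^sub>M PiM {1..n} (\<lambda>_. borel)"
  using assms unfolding info_space_def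
  by (auto intro!: measurable_compose[OF measurable_component_singleton] measurable_fst measurable_snd)

lemma lik_measurable_awake [measurable (raw)]:
  assumes [measurable]: "r \<in> borel_measurable borel" "m \<in> N \<rightarrow>\<^sub>M count_space UNIV"
    "y \<in> N \<rightarrow>\<^sub>M PiM {1..n} (\<lambda>_. borel)"
  shows "(\<lambda>x. lik r (m x) (y x)) \<in> borel_measurable N"
  unfolding lik_def by measurable

lemma joint_measurable:
  assumes "k \<le> K"
  shows "joint0 k \<in> borel_measurable (info_space n K)" "joint1 k \<in> borel_measurable (info_space n K)"
proof -
  have "k \<le> K \<Longrightarrow> joint0 k \<in> borel_measurable (info_space n K) \<and> joint1 k \<in> borel_measurable (info_space n K)" for k
  proof (induction k)
    case (Suc k)
    then have [measurable]: "joint0 k \<in> borel_measurable (info_space n K)"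
      "joint1 k \<in> borel_measurable (info_space n K)"
      by auto
    have [measurable]: "(\<lambda>I. fst (I k)) \<in> info_space n K \<rightarrow>\<^sub>M count_space UNIV"
      "(\<lambda>I. snd (I k)) \<in> info_space n K \<rightarrow>\<^sub>M PiM {1..n} (\<lambda>_. borel)"
      using Suc.prems by (intro info_component_measurable; simp)+
    have "joint0 (Suc k) = (\<lambda>I. ennreal (1 - p) * joint0 k I * lik r0 (awake (fst (I k))) (snd (I k)))"
      "joint1 (Suc k) = (\<lambda>I. (joint1 k I + ennreal p * joint0 k I) * lik r1 (awake (fst (I k))) (snd (I k)))"
      by (simp_all add: fun_eq_iff)
    then show ?case by simp
  next
    case 0
    have "joint0 0 = (\<lambda>I. ennreal (1 - rho))" "joint1 0 = (\<lambda>I. ennreal rho)"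
      by (simp_all add: fun_eq_iff)
    then show ?case by simp
  qed
  with assms show "joint0 k \<in> borel_measurable (info_space n K)" "joint1 k \<in> borel_measurable (info_space n K)"
    by auto
qed

lemmas joint_measurable' [measurable] = joint_measurable[OF order_refl]

lemma filter_prob_measurable [measurable]: "filter_prob k \<in> borel_measurable (info_space n k)"
  unfolding filter_prob_def by measurable

lemma continuation_measurable:
  "(\<lambda>(a, b). continuation W m a b) \<in> borel_measurable (borel \<Otimes>\<^sub>M borel)"
proof -
  interpret R: sigma_finite_measure R by (rule sigma_finite_R)
  show ?thesis unfolding continuation_def by measurable
qed

lemma best_awake:
  "best_awake a b \<le> n"
  "continuation W (best_awake a b) a b = (INF m\<in>{0..n}. continuation W m a b)"
proof -
  have "\<exists>m\<in>{0..n}. \<forall>m'\<in>{0..n}. continuation W m a b \<le> continuation W m' a b"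
    using ex_min_if_finite[of "(\<lambda>m. continuation W m a b) ` {0..n}"] by (force simp: not_less)
  then have "\<exists>m. m \<le> n \<and> (\<forall>m'\<le>n. continuation W m a b \<le> continuation W m' a b)" by auto
  from LeastI_ex[OF this]
  have *: "best_awake a b \<le> n \<and> (\<forall>m'\<le>n. continuation W (best_awake a b) a b \<le> continuation W m' a b)"
    unfolding best_awake_def .
  then show "best_awake a b \<le> n" by simp
  show "continuation W (best_awake a b) a b = (INF m\<in>{0..n}. continuation W m a b)"
    using * by (intro antisym INF_greatest INF_lower) auto
qed

lemma threshold_policy_admissible: "admissible n threshold_policy"
  unfolding admissible_def
proof
  fix k
  have [measurable]: "(\<lambda>I. best_awake (joint1 k I) (joint0 k I)) \<in> info_space n k \<rightarrow>\<^sub>M count_space UNIV"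
  proof -
    have "(\<lambda>I. continuation W m (joint1 k I) (joint0 k I)) \<in> borel_measurable (info_space n k)" for m
      using measurable_compose[OF measurable_Pair[OF joint_measurable'(2) joint_measurable'(1)]
        continuation_measurable] by simp
    then show ?thesis unfolding best_awake_def by (rule measurable_least_minimizer)
  qed
  have "threshold_policy k = (\<lambda>I. if threshold \<le> filter_prob k I then Stop
      else Continue (best_awake (joint1 k I) (joint0 k I)))"
    by (simp add: fun_eq_iff threshold_policy_def)
  then have "threshold_policy k \<in> info_space n k \<rightarrow>\<^sub>M count_space UNIV"
    by simp
  moreover have "threshold_policy k I \<in> actions n" for I
    using best_awake(1) by (simp add: threshold_policy_def actions_def image_iff)
  moreover have "finite (actions n)"
    by (simp add: actions_def)
  ultimately show "threshold_policy k \<in> info_space n k \<rightarrow>\<^sub>M count_space (actions n)"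
    by (simp add: measurable_count_space_eq2 measurable_sets)
qed

section \<open>Verification\<close>

abbreviation extend :: "policy \<Rightarrow> nat \<Rightarrow> info \<Rightarrow> (nat \<Rightarrow> real) \<Rightarrow> info" where
  "extend \<mu> k I y \<equiv> I(k := (\<mu> k I, received n (\<mu> k I) y))"

lemma extend_measurable:
  assumes "admissible n \<mu>"
  shows "(\<lambda>(I, y). extend \<mu> k I y) \<in> info_space n k \<Otimes>\<^sub>M R \<rightarrow>\<^sub>M info_space n (Suc k)"
proof -
  have [measurable]: "\<mu> k \<in> info_space n k \<rightarrow>\<^sub>M count_space UNIV"
    by (rule admissible_measurable[OF assms])
  have "(\<lambda>z. (fst z)(k := (\<mu> k (fst z), received n (\<mu> k (fst z)) (snd z))))
      \<in> info_space n k \<Otimes>\<^sub>M R \<rightarrow>\<^sub>M info_space n (Suc k)"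
    by (rule info_extend_measurable) measurable
  then show ?thesis by (simp add: case_prod_beta)
qed

lemma extend_space:
  assumes "admissible n \<mu>" "I \<in> space (info_space n k)" "y \<in> space R"
  shows "extend \<mu> k I y \<in> space (info_space n (Suc k))"
  using measurable_space[OF extend_measurable[OF assms(1)], of "(I, y)"] assms
  by (simp add: space_pair_measure)

lemma extend_measurable_snd:
  assumes "admissible n \<mu>" "I \<in> space (info_space n k)" "g \<in> borel_measurable (info_space n (Suc k))"
  shows "(\<lambda>y. g (extend \<mu> k I y)) \<in> borel_measurable R"
  using measurable_compose[OF measurable_compose[OF measurable_Pair1'[OF assms(2)]
      extend_measurable[OF assms(1)]] assms(3)] by simp

lemma extend_integral_measurable:
  assumes "admissible n \<mu>" "g \<in> borel_measurable (info_space n (Suc k))"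
  shows "(\<lambda>I. \<integral>\<^sup>+y. g (extend \<mu> k I y) \<partial>R) \<in> borel_measurable (info_space n k)"
proof -
  interpret R: sigma_finite_measure R by (rule sigma_finite_R)
  show ?thesis
    using measurable_compose[OF extend_measurable[OF assms(1)] assms(2)]
    by (intro R.borel_measurable_nn_integral) (simp add: case_prod_beta)
qed

lemma space_info_0: "(\<lambda>_. undefined) \<in> space (info_space n 0)"
  by (simp add: info_space_def space_PiM)

section \<open>Calculus of the reference integral\<close>

lemma ref_integral_mono:
  assumes "admissible n \<mu>" "\<And>I. I \<in> space (info_space n k) \<Longrightarrow> g I \<le> h I"
  shows "ref_integral \<mu> k g \<le> ref_integral \<mu> k h"
  using assms(2)
proof (induction k arbitrary: g h)
  case 0
  then show ?case using space_info_0 by simp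
next
  case (Suc k)
  show ?case
    unfolding ref_integral.simps
    by (intro Suc.IH nn_integral_mono Suc.prems extend_space assms(1))
qed

lemma ref_integral_cong:
  assumes "admissible n \<mu>" "\<And>I. I \<in> space (info_space n k) \<Longrightarrow> g I = h I"
  shows "ref_integral \<mu> k g = ref_integral \<mu> k h"
  by (intro antisym ref_integral_mono assms(1)) (simp_all add: assms(2))

lemma ref_integral_add:
  assumes "admissible n \<mu>" "g \<in> borel_measurable (info_space n k)" "h \<in> borel_measurable (info_space n k)"
  shows "ref_integral \<mu> k (\<lambda>I. g I + h I) = ref_integral \<mu> k g + ref_integral \<mu> k h"
  using assms(2,3)
proof (induction k arbitrary: g h)
  case (Suc k)
  have "ref_integral \<mu> (Suc k) (\<lambda>I. g I + h I)
      = ref_integral \<mu> k (\<lambda>I. (\<integral>\<^sup>+y. g (extend \<mu> k I y) \<partial>R) + (\<integral>\<^sup>+y. h (extend \<mu> k I y) \<partial>R))"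
    unfolding ref_integral.simps
    by (intro ref_integral_cong assms(1) nn_integral_add extend_measurable_snd Suc.prems)
  also have "\<dots> = ref_integral \<mu> (Suc k) g + ref_integral \<mu> (Suc k) h"
    unfolding ref_integral.simps
    by (intro Suc.IH extend_integral_measurable Suc.prems assms(1))
  finally show ?case .
qed simp

lemma ref_integral_cmult:
  assumes "admissible n \<mu>" "g \<in> borel_measurable (info_space n k)"
  shows "ref_integral \<mu> k (\<lambda>I. c * g I) = c * ref_integral \<mu> k g"
  using assms(2)
proof (induction k arbitrary: g)
  case (Suc k)
  have "ref_integral \<mu> (Suc k) (\<lambda>I. c * g I)
      = ref_integral \<mu> k (\<lambda>I. c * (\<integral>\<^sup>+y. g (extend \<mu> k I y) \<partial>R))"
    unfolding ref_integral.simps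
    by (intro ref_integral_cong assms(1) nn_integral_cmult extend_measurable_snd Suc.prems)
  also have "\<dots> = c * ref_integral \<mu> (Suc k) g"
    unfolding ref_integral.simps
    by (intro Suc.IH extend_integral_measurable Suc.prems assms(1))
  finally show ?case .
qed simp

text \<open>This is the prior probability of \<open>T > k\<close>, independent of the policy: each
  slot contributes the factor \<open>1 - p\<close>, because \<open>lik r0\<close> integrates to 1
  for any number of awake sensors.\<close>

lemma ref_integral_joint0:
  assumes "admissible n \<mu>"
  shows "ref_integral \<mu> k (joint0 k) = ennreal ((1 - rho) * (1 - p) ^ k)"
proof (induction k)
  case 0
  then show ?case by simp
next
  case (Suc k)
  have "ref_integral \<mu> (Suc k) (joint0 (Suc k))
      = ref_integral \<mu> k (\<lambda>I. ennreal (1 - p) * joint0 k I)"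
    unfolding ref_integral.simps joint_extend
    by (simp add: nn_integral_cmult lik_integral r_int)
  also have "\<dots> = ennreal (1 - p) * ennreal ((1 - rho) * (1 - p) ^ k)"
    by (simp add: ref_integral_cmult assms Suc)
  also have "\<dots> = ennreal ((1 - rho) * (1 - p) ^ Suc k)"
    using p rho by (simp add: ennreal_mult[symmetric] mult_ac)
  finally show ?case .
qed

lemma alive_measurable [measurable]: "Measurable.pred (info_space n k) (alive k)"
proof -
  have "Measurable.pred (info_space n k) (\<lambda>I. fst (I j) \<noteq> Stop)" if "j < k" for j
    using measurable_compose[OF info_component_measurable(1)[OF that], of "\<lambda>A. A \<noteq> Stop" "count_space UNIV"]
    by simp
  then show ?thesis
    unfolding alive_def[abs_def] by (simp add: Ball_def[symmetric] lessThan_iff[symmetric] del: lessThan_iff)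
qed

lemma stage_cost_measurable:
  assumes "admissible n \<mu>"
  shows "stage_cost \<mu> k \<in> borel_measurable (info_space n k)"
proof -
  have [measurable]: "\<mu> k \<in> info_space n k \<rightarrow>\<^sub>M count_space UNIV"
    by (rule admissible_measurable[OF assms])
  show ?thesis unfolding stage_cost_def[abs_def] by measurable
qed

lemma value_alive_measurable: "value_alive k \<in> borel_measurable (info_space n k)"
  unfolding value_alive_def[abs_def] by measurable

lemma value_alive_extend:
  "(\<integral>\<^sup>+y. value_alive (Suc k) (extend \<mu> k I y) \<partial>R) =
    (if \<not> alive k I \<or> \<mu> k I = Stop then 0
     else \<integral>\<^sup>+y. W ((joint1 k I + ennreal p * joint0 k I) * lik r1 (awake (\<mu> k I)) y)
         (ennreal (1 - p) * joint0 k I * lik r0 (awake (\<mu> k I)) y) \<partial>R)"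
  unfolding value_alive_def alive_upd joint_extend
  by (cases "alive k I \<and> \<mu> k I \<noteq> Stop") auto

text \<open>An alarm costs at least \<open>W\<close> and leaves no value behind, as the recorded
  \<open>Stop\<close> ends \<open>alive\<close>; a continuation uses one particular \<open>m\<close>
  and so is no better than the infimum in the Bellman equation.\<close>

lemma value_alive_le:
  assumes "\<mu> k I \<in> actions n"
  shows "value_alive k I \<le> stage_cost \<mu> k I + (\<integral>\<^sup>+y. value_alive (Suc k) (extend \<mu> k I y) \<partial>R)"
proof (cases "\<mu> k I")
  case Stop
  then show ?thesis
    unfolding value_alive_extend by (simp add: value_alive_def stage_cost_def W_le)
next
  case (Continue m)
  then have m: "m \<in> {0..n}" using assms by (auto simp: actions_def)
  have "W (joint1 k I) (joint0 k I) \<le> continuation W m (joint1 k I) (joint0 k I)"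
    unfolding W_fixed_point[OF joint_finite(1)] bellman_def
    by (rule min.coboundedI2) (rule INF_lower[OF m])
  then show ?thesis
    using Continue unfolding value_alive_extend
    by (simp add: value_alive_def stage_cost_def continuation_def)
qed

lemma value_alive_eq:
  "value_alive k I = stage_cost threshold_policy k I
     + (\<integral>\<^sup>+y. value_alive (Suc k) (extend threshold_policy k I y) \<partial>R)"
proof (cases "threshold \<le> filter_prob k I")
  case True
  then have "threshold_policy k I = Stop" by (simp add: threshold_policy_def)
  moreover have "W (joint1 k I) (joint0 k I) = ennreal lam_f * joint0 k I"
    using True by (intro W_eq_stop_or_continue(1) joint_finite) (simp add: filter_prob_def)
  ultimately show ?thesis
    unfolding value_alive_extend by (simp add: value_alive_def stage_cost_def)
next
  case False
  then have "threshold_policy k I = Continue (best_awake (joint1 k I) (joint0 k I))"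
    by (simp add: threshold_policy_def)
  moreover have "W (joint1 k I) (joint0 k I)
      = continuation W (best_awake (joint1 k I) (joint0 k I)) (joint1 k I) (joint0 k I)"
    unfolding best_awake(2)
    using False by (intro W_eq_stop_or_continue(2) joint_finite) (simp add: filter_prob_def)
  ultimately show ?thesis
    unfolding value_alive_extend by (simp add: value_alive_def stage_cost_def continuation_def)
qed

lemma ref_integral_step:
  assumes "admissible n \<mu>"
  shows "ref_integral \<mu> k (\<lambda>I. stage_cost \<mu> k I + (\<integral>\<^sup>+y. value_alive (Suc k) (extend \<mu> k I y) \<partial>R))
    = ref_integral \<mu> k (stage_cost \<mu> k) + ref_integral \<mu> (Suc k) (value_alive (Suc k))"
  by (simp add: ref_integral_add assms stage_cost_measurable extend_integral_measurable
    value_alive_measurable)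

lemma value_alive_0: "ref_integral \<mu> 0 (value_alive 0) = W (ennreal rho) (ennreal (1 - rho))"
  by (simp add: value_alive_def alive_def)

lemma W_le_total_cost:
  assumes "admissible n \<mu>"
  shows "W (ennreal rho) (ennreal (1 - rho)) \<le> (\<Sum>k. ref_integral \<mu> k (stage_cost \<mu> k))"
proof -
  let ?W = "W (ennreal rho) (ennreal (1 - rho))"
  let ?c = "\<lambda>k. ref_integral \<mu> k (stage_cost \<mu> k)"
  have partial: "?W \<le> (\<Sum>k<N. ?c k) + ref_integral \<mu> N (value_alive N)" for N
  proof (induction N)
    case 0
    then show ?case by (simp add: value_alive_0 del: ref_integral.simps)
  next
    case (Suc N)
    have "ref_integral \<mu> N (value_alive N) \<le> ?c N + ref_integral \<mu> (Suc N) (value_alive (Suc N))"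
      unfolding ref_integral_step[OF assms, symmetric]
      by (intro ref_integral_mono assms value_alive_le admissible_range)
    then have "(\<Sum>k<N. ?c k) + ref_integral \<mu> N (value_alive N)
      \<le> (\<Sum>k<N. ?c k) + (?c N + ref_integral \<mu> (Suc N) (value_alive (Suc N)))"
      by (rule add_left_mono)
    with Suc have "?W \<le> (\<Sum>k<N. ?c k) + (?c N + ref_integral \<mu> (Suc N) (value_alive (Suc N)))"
      by (rule order_trans)
    then show ?case by (simp add: add.assoc del: ref_integral.simps)
  qed
  have "?W \<le> (\<Sum>k. ?c k) + ennreal (lam_f * ((1 - rho) * (1 - p) ^ N))" for N
  proof -
    have "ref_integral \<mu> N (value_alive N) \<le> ref_integral \<mu> N (\<lambda>I. ennreal lam_f * joint0 N I)"
      by (intro ref_integral_mono assms) (simp add: value_alive_def W_le)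
    also have "\<dots> = ennreal (lam_f * ((1 - rho) * (1 - p) ^ N))"
      using lam p rho by (simp add: ref_integral_cmult ref_integral_joint0 assms ennreal_mult[symmetric])
    finally have "(\<Sum>k<N. ?c k) + ref_integral \<mu> N (value_alive N)
      \<le> (\<Sum>k. ?c k) + ennreal (lam_f * ((1 - rho) * (1 - p) ^ N))"
      by (intro add_mono sum_le_suminf) auto
    with partial[of N] show ?thesis by (rule order_trans)
  qed
  moreover have "(\<lambda>N. (\<Sum>k. ?c k) + ennreal (lam_f * ((1 - rho) * (1 - p) ^ N)))
      \<longlonglongrightarrow> (\<Sum>k. ?c k) + ennreal (lam_f * ((1 - rho) * 0))"
    using p by (intro tendsto_intros LIMSEQ_power_zero) auto
  ultimately show ?thesis
    by (intro LIMSEQ_le_const[where X = "\<lambda>N. (\<Sum>k. ?c k) + ennreal (lam_f * ((1 - rho) * (1 - p) ^ N))"]) auto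
qed

text \<open>For this policy the one-step inequality is an equality. Dropping the nonnegative
  remainder bounds the partial sums, so here the remainder need not be shown to vanish.\<close>

lemma total_cost_threshold_policy:
  "(\<Sum>k. ref_integral threshold_policy k (stage_cost threshold_policy k))
     \<le> W (ennreal rho) (ennreal (1 - rho))"
proof -
  let ?\<mu> = threshold_policy
  let ?c = "\<lambda>k. ref_integral ?\<mu> k (stage_cost ?\<mu> k)"
  have "W (ennreal rho) (ennreal (1 - rho)) = (\<Sum>k<N. ?c k) + ref_integral ?\<mu> N (value_alive N)" for N
  proof (induction N)
    case 0
    then show ?case by (simp add: value_alive_0 del: ref_integral.simps)
  next
    case (Suc N)
    have "ref_integral ?\<mu> N (value_alive N) = ?c N + ref_integral ?\<mu> (Suc N) (value_alive (Suc N))"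
      unfolding ref_integral_step[OF threshold_policy_admissible, symmetric]
      by (intro ref_integral_cong threshold_policy_admissible value_alive_eq)
    with Suc show ?case by (simp add: add.assoc del: ref_integral.simps)
  qed
  then have "(\<Sum>k<N. ?c k) \<le> W (ennreal rho) (ennreal (1 - rho))" for N
    by (metis le_iff_add)
  then show ?thesis by (intro suminf_le_const) auto
qed

end

section \<open>One step of the information process\<close>

lemma received_restrict: "received n A (\<lambda>i\<in>{1..n}. y i) = received n A y"
  unfolding received_def by (intro restrict_ext) simp

lemma info_Suc:
  "info n X \<mu> (Suc k) \<omega> = (info n X \<mu> k \<omega>)
     (k := (\<mu> k (info n X \<mu> k \<omega>), received n (\<mu> k (info n X \<mu> k \<omega>)) (\<lambda>i. X (Suc k) i \<omega>)))"
  by (simp add: Let_def received_def)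

lemma info_measurable:
  assumes "admissible n \<mu>"
    and "\<And>j i. 1 \<le> j \<Longrightarrow> j \<le> k \<Longrightarrow> i \<in> {1..n} \<Longrightarrow> X j i \<in> borel_measurable N"
  shows "info n X \<mu> k \<in> N \<rightarrow>\<^sub>M info_space n k"
  using assms(2)
proof (induction k)
  case 0
  have "info n X \<mu> 0 = (\<lambda>_ _. undefined)" by (simp add: fun_eq_iff)
  then show ?case by (simp add: info_space_def space_PiM)
next
  case (Suc k)
  then have [measurable]: "info n X \<mu> k \<in> N \<rightarrow>\<^sub>M info_space n k" by simp
  note admissible_measurable[OF assms(1), measurable]
  show ?case
    unfolding info_Suc[abs_def] by (rule info_extend_measurable) (use Suc.prems in auto)
qed

lemma info_cong:
  assumes "\<And>j i. 1 \<le> j \<Longrightarrow> j \<le> k \<Longrightarrow> i \<in> {1..n} \<Longrightarrow> X j i \<omega> = X' j i \<omega>'"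
  shows "info n X \<mu> k \<omega> = info n X' \<mu> k \<omega>'"
  using assms
proof (induction k)
  case (Suc k)
  then have "info n X \<mu> k \<omega> = info n X' \<mu> k \<omega>'" by simp
  moreover have "received n A (\<lambda>i. X (Suc k) i \<omega>) = received n A (\<lambda>i. X' (Suc k) i \<omega>')" for A
    unfolding received_def by (intro restrict_ext) (simp add: Suc.prems)
  ultimately show ?case by (simp only: info_Suc)
qed simp

text \<open>The information at \<open>k\<close> depends only on slots up to \<open>k\<close>, hence
  is independent of the whole observation vector of slot \<open>Suc k\<close>, even though the
  policy selects which part of that vector is received. Fubini integrates the vector out.\<close>

lemma (in prob_space) nn_integral_info_Suc:
  fixes X :: "nat \<Rightarrow> nat \<Rightarrow> 'a \<Rightarrow> real"
  assumes \<mu>: "admissible n \<mu>"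
    and n: "1 \<le> n"
    and ind: "indep_vars (\<lambda>_. borel) (\<lambda>(k, i). X k i) ({1..} \<times> {1..n})"
    and law: "\<And>i. i \<in> {1..n} \<Longrightarrow> distr M borel (X (Suc k) i) = D"
    and g: "g \<in> borel_measurable (info_space n (Suc k))"
  shows "(\<integral>\<^sup>+\<omega>. g (info n X \<mu> (Suc k) \<omega>) \<partial>M)
    = (\<integral>\<^sup>+\<omega>. (\<integral>\<^sup>+y. g ((info n X \<mu> k \<omega>)
        (k := (\<mu> k (info n X \<mu> k \<omega>), received n (\<mu> k (info n X \<mu> k \<omega>)) y))) \<partial>PiM {1..n} (\<lambda>_. D)) \<partial>M)"
proof -
  define Z where "Z = (\<lambda>(k, i). X k i)"
  define A where "A = {1..k} \<times> {1..n}"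
  define B where "B = {Suc k} \<times> {1..n}"
  define P where "P = PiM {1..n} (\<lambda>_. borel :: real measure)"
  \<comment> \<open>The coordinate maps take the role of the sensor signals and the family
    \<open>z\<close> that of the outcome; this exhibits the information as a measurable function of
    the restriction of \<open>Z\<close> to \<open>A\<close>.\<close>
  define FI where "FI = (\<lambda>z. info n (\<lambda>j i (z :: nat \<times> nat \<Rightarrow> real). z (j, i)) \<mu> k z)"
  define FY where "FY = (\<lambda>(z :: nat \<times> nat \<Rightarrow> real). \<lambda>i\<in>{1..n}. z (Suc k, i))"
  let ?I = "info n X \<mu> k" and ?Y = "\<lambda>\<omega>. \<lambda>i\<in>{1..n}. X (Suc k) i \<omega>"
  have X_meas: "X j i \<in> borel_measurable M" if "1 \<le> j" "i \<in> {1..n}" for j i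
    using ind that unfolding indep_vars_def by force
  \<comment> \<open>\<open>D\<close> is given only as the common law of the sensors; sensor 1,
    present because of \<open>1 \<le> n\<close>, shows that it is a probability measure on the Borel
    sets.\<close>
  have D: "prob_space D" "sets D = sets borel"
    using prob_space_distr[OF X_meas[of "Suc k" 1]] law[of 1] n by (auto simp flip: law[of 1])
  have ind': "indep_var (PiM A (\<lambda>_. borel)) (\<lambda>\<omega>. restrict (\<lambda>i. Z i \<omega>) A) (PiM B (\<lambda>_. borel)) (\<lambda>\<omega>. restrict (\<lambda>i. Z i \<omega>) B)"
    using ind by (intro indep_var_restrict) (auto simp: A_def B_def Z_def)
  have FI_meas: "FI \<in> PiM A (\<lambda>_. borel) \<rightarrow>\<^sub>M info_space n k"
    unfolding FI_def
    by (intro info_measurable \<mu> measurable_component_singleton) (auto simp: A_def)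
  have FY_meas: "FY \<in> PiM B (\<lambda>_. borel) \<rightarrow>\<^sub>M P"
    unfolding FY_def P_def
    by (intro measurable_restrict measurable_component_singleton) (auto simp: B_def)
  have FI_eq: "FI (restrict (\<lambda>i. Z i \<omega>) A) = ?I \<omega>" for \<omega>
    unfolding FI_def by (intro info_cong) (auto simp: A_def Z_def)
  have FY_eq: "FY (restrict (\<lambda>i. Z i \<omega>) B) = ?Y \<omega>" for \<omega>
    by (auto simp: FY_def B_def Z_def fun_eq_iff)
  let ?SA = "PiM A (\<lambda>_. borel :: real measure)" and ?SB = "PiM B (\<lambda>_. borel :: real measure)"
  let ?ZA = "\<lambda>\<omega>. restrict (\<lambda>i. Z i \<omega>) A" and ?ZB = "\<lambda>\<omega>. restrict (\<lambda>i. Z i \<omega>) B"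
  from ind' have rv: "?ZA \<in> M \<rightarrow>\<^sub>M ?SA" "?ZB \<in> M \<rightarrow>\<^sub>M ?SB"
    and prod: "distr M (?SA \<Otimes>\<^sub>M ?SB) (\<lambda>\<omega>. (?ZA \<omega>, ?ZB \<omega>)) = distr M ?SA ?ZA \<Otimes>\<^sub>M distr M ?SB ?ZB"
    by (auto simp: indep_var_distribution_eq)
  have "indep_vars (\<lambda>_. borel) Z B"
    using ind unfolding Z_def by (rule indep_vars_subset) (auto simp: B_def)
  then have B_law: "distr M (PiM B (\<lambda>_. borel)) (\<lambda>\<omega>. restrict (\<lambda>b. Z b \<omega>) B) = PiM B (\<lambda>_. D)"
    using n X_meas law
    by (subst (asm) indep_vars_iff_distr_eq_PiM') (auto simp: B_def Z_def intro!: PiM_cong)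
  have Y_law: "distr (distr M ?SB ?ZB) P FY = PiM {1..n} (\<lambda>_. D)"
  proof -
    have "distr (distr M ?SB ?ZB) P FY = distr (PiM B (\<lambda>_. D)) (PiM {1..n} (\<lambda>_. D)) (\<lambda>z. \<lambda>i\<in>{1..n}. z (Suc k, i))"
      unfolding B_law P_def FY_def using D(2) by (intro distr_cong sets_PiM_cong) auto
    also have "\<dots> = PiM {1..n} (\<lambda>_. D)"
      by (rule distr_PiM_reindex) (auto simp: B_def D inj_on_def)
    finally show ?thesis .
  qed
  have \<mu>_meas [measurable]: "\<mu> k \<in> info_space n k \<rightarrow>\<^sub>M count_space UNIV"
    by (rule admissible_measurable[OF \<mu>])
  define h where "h = (\<lambda>z. g ((fst z)(k := (\<mu> k (fst z), received n (\<mu> k (fst z)) (snd z)))))"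
  have h: "h \<in> borel_measurable (info_space n k \<Otimes>\<^sub>M P)"
    unfolding h_def P_def
    by (rule measurable_compose[OF info_extend_measurable g]) measurable
  interpret ZB: prob_space "distr M ?SB ?ZB" by (intro prob_space_distr rv)
  have hF: "(\<lambda>(a, b). h (FI a, FY b)) \<in> borel_measurable (?SA \<Otimes>\<^sub>M ?SB)"
    using FI_meas FY_meas h by (simp add: case_prod_beta)
  then have hF': "(\<lambda>(a, b). h (FI a, FY b)) \<in> borel_measurable (?SA \<Otimes>\<^sub>M distr M ?SB ?ZB)"
    by simp
  have "(\<integral>\<^sup>+\<omega>. g (info n X \<mu> (Suc k) \<omega>) \<partial>M) = (\<integral>\<^sup>+\<omega>. h (?I \<omega>, ?Y \<omega>) \<partial>M)"
    unfolding info_Suc h_def fst_conv snd_conv received_restrict ..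
  also have "\<dots> = (\<integral>\<^sup>+\<omega>. (\<lambda>(a, b). h (FI a, FY b)) (?ZA \<omega>, ?ZB \<omega>) \<partial>M)"
    by (simp only: prod.case FI_eq FY_eq)
  also have "\<dots> = (\<integral>\<^sup>+z. (\<lambda>(a, b). h (FI a, FY b)) z \<partial>(distr M ?SA ?ZA \<Otimes>\<^sub>M distr M ?SB ?ZB))"
    unfolding prod[symmetric] using rv hF by (subst nn_integral_distr) auto
  also have "\<dots> = (\<integral>\<^sup>+a. (\<integral>\<^sup>+b. h (FI a, FY b) \<partial>distr M ?SB ?ZB) \<partial>distr M ?SA ?ZA)"
    using hF by (subst ZB.nn_integral_fst[symmetric]) (auto cong: measurable_cong_sets)
  also have "\<dots> = (\<integral>\<^sup>+\<omega>. (\<integral>\<^sup>+b. h (FI (?ZA \<omega>), FY b) \<partial>distr M ?SB ?ZB) \<partial>M)"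
    using rv ZB.borel_measurable_nn_integral_fst[OF hF'] by (subst nn_integral_distr) auto
  also have "\<dots> = (\<integral>\<^sup>+\<omega>. (\<integral>\<^sup>+b. h (?I \<omega>, FY b) \<partial>distr M ?SB ?ZB) \<partial>M)"
    by (simp only: FI_eq)
  also have "\<dots> = (\<integral>\<^sup>+\<omega>. (\<integral>\<^sup>+y. h (?I \<omega>, y) \<partial>PiM {1..n} (\<lambda>_. D)) \<partial>M)"
  proof (rule nn_integral_cong)
    fix \<omega> assume "\<omega> \<in> space M"
    then have "?I \<omega> \<in> space (info_space n k)"
      using measurable_space[OF FI_meas measurable_space[OF rv(1)]] by (simp only: FI_eq)
    then have "(\<lambda>y. h (?I \<omega>, y)) \<in> borel_measurable P" using h by simp
    then show "(\<integral>\<^sup>+b. h (?I \<omega>, FY b) \<partial>distr M ?SB ?ZB) = (\<integral>\<^sup>+y. h (?I \<omega>, y) \<partial>PiM {1..n} (\<lambda>_. D))"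
      unfolding Y_law[symmetric] using FY_meas by (subst nn_integral_distr) auto
  qed
  finally show ?thesis by (simp add: h_def)
qed


text \<open>Coordinates that are overwritten by a constant can be dropped from a product density.\<close>

lemma distr_density_PiM_coordinatewise:
  fixes K :: "'b measure" and w :: "'i \<Rightarrow> 'b \<Rightarrow> ennreal" and c :: "'i \<Rightarrow> 'b \<Rightarrow> 'c"
  assumes I: "finite I" and K: "prob_space K"
    and w [measurable]: "\<And>i. w i \<in> borel_measurable K"
    and c [measurable]: "\<And>i. c i \<in> K \<rightarrow>\<^sub>M N"
    and one: "\<And>i. (\<integral>\<^sup>+x. w i x \<partial>K) = 1"
  shows "distr (density (PiM I (\<lambda>_. K)) (\<lambda>y. \<Prod>i\<in>I. w i (y i))) (PiM I (\<lambda>_. N)) (\<lambda>y. \<lambda>i\<in>I. c i (y i))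
    = PiM I (\<lambda>i. distr (density K (w i)) N (c i))"
proof -
  interpret K: product_prob_space "\<lambda>_. K"
    by (intro product_prob_spaceI K)
  have "prob_space (distr (density K (w i)) N (c i))" for i
    by (intro prob_space.prob_space_distr prob_spaceI) (simp_all add: emeasure_density one cong: nn_integral_cong)
  then interpret product_prob_space "\<lambda>i. distr (density K (w i)) N (c i)"
    by (intro product_prob_spaceI)
  show ?thesis
  proof (rule PiM_eqI[OF I])
    fix A assume "\<And>i. i \<in> I \<Longrightarrow> A i \<in> sets (distr (density K (w i)) N (c i))"
    then have A [measurable]: "i \<in> I \<Longrightarrow> A i \<in> sets N" for i by simp
    let ?c = "\<lambda>y. \<lambda>i\<in>I. c i (y i)" and ?w = "\<lambda>y. \<Prod>i\<in>I. w i (y i)"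
    have c' [measurable]: "?c \<in> PiM I (\<lambda>_. K) \<rightarrow>\<^sub>M PiM I (\<lambda>_. N)"
      by measurable
    have box [measurable]: "Pi\<^sub>E I A \<in> sets (PiM I (\<lambda>_. N))"
      using I A by (intro sets_PiM_I_finite) auto
    have cA: "c i -` A i \<inter> space K \<in> sets K" if "i \<in> I" for i
      using that A by (intro measurable_sets[OF c])
    have "emeasure (distr (density (PiM I (\<lambda>_. K)) ?w) (PiM I (\<lambda>_. N)) ?c) (Pi\<^sub>E I A)
      = (\<integral>\<^sup>+y. ?w y * indicator (?c -` Pi\<^sub>E I A \<inter> space (PiM I (\<lambda>_. K))) y \<partial>PiM I (\<lambda>_. K))"
      using box c' by (subst emeasure_distr) (auto intro!: emeasure_density measurable_sets[OF c'])
    also have "\<dots> = (\<integral>\<^sup>+y. (\<Prod>i\<in>I. w i (y i) * indicator (c i -` A i \<inter> space K) (y i)) \<partial>PiM I (\<lambda>_. K))"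
    proof (rule nn_integral_cong)
      fix y assume y: "y \<in> space (PiM I (\<lambda>_. K))"
      then have "indicator (?c -` Pi\<^sub>E I A \<inter> space (PiM I (\<lambda>_. K))) y
        = (\<Prod>i\<in>I. indicator (c i -` A i \<inter> space K) (y i) :: ennreal)"
        using I by (auto simp: space_PiM PiE_iff indicator_def prod_zero_iff split: if_splits)
      then show "?w y * indicator (?c -` Pi\<^sub>E I A \<inter> space (PiM I (\<lambda>_. K))) y
        = (\<Prod>i\<in>I. w i (y i) * indicator (c i -` A i \<inter> space K) (y i))"
        by (simp add: prod.distrib)
    qed
    also have "\<dots> = (\<Prod>i\<in>I. \<integral>\<^sup>+x. w i x * indicator (c i -` A i \<inter> space K) x \<partial>K)"
      using I cA by (intro K.product_nn_integral_prod) auto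
    also have "\<dots> = (\<Prod>i\<in>I. emeasure (distr (density K (w i)) N (c i)) (A i))"
      using A cA by (intro prod.cong refl) (simp add: emeasure_distr emeasure_density)
    finally show "emeasure (distr (density (PiM I (\<lambda>_. K)) ?w) (PiM I (\<lambda>_. N)) ?c) (Pi\<^sub>E I A)
      = (\<Prod>i\<in>I. emeasure (distr (density K (w i)) N (c i)) (A i))" .
  qed (simp, intro sets_PiM_cong refl, simp)
qed

section \<open>Change of measure for the received observations\<close>

context detection
begin

text \<open>On both sides the received vector has independent coordinates, with law
  \<open>density L r\<close> for awake sensors and a point mass at 0 for sleeping ones. The left
  side draws all \<open>n\<close> sensors with density \<open>r\<close>, the right side reweights
  the awake ones only.\<close>

lemma nn_integral_received_density:
  assumes r [measurable]: "r \<in> borel_measurable borel" and one: "(\<integral>\<^sup>+x. r x \<partial>L) = 1"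
    and g [measurable]: "g \<in> borel_measurable (PiM {1..n} (\<lambda>_. borel))"
  shows "(\<integral>\<^sup>+y. g (received n A y) \<partial>PiM {1..n} (\<lambda>_. density L r))
    = (\<integral>\<^sup>+y. g (received n A y) * lik r (awake A) y \<partial>R)"
proof -
  define m where "m = awake A"
  define c where "c i x = (if i \<le> m then x else 0)" for i :: nat and x :: real
  define w where "w i x = (if i \<le> m then r x else 1)" for i :: nat and x :: real
  let ?P = "PiM {1..n} (\<lambda>_. borel :: real measure)"
  have L1: "emeasure L (space L) = 1" by (rule emeasure_space_1)
  have D: "prob_space (density L r)"
    using one by (intro prob_spaceI) (simp add: emeasure_density cong: nn_integral_cong)
  have rec: "received n A = (\<lambda>y. \<lambda>i\<in>{1..n}. c i (y i))"
    by (simp add: received_def c_def m_def fun_eq_iff restrict_def)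
  have lik: "lik r m = (\<lambda>y. \<Prod>i\<in>{1..n}. w i (y i))"
    by (simp add: lik_def w_def fun_eq_iff)
  have c_meas [measurable]: "c i \<in> borel_measurable borel" for i
    unfolding c_def[abs_def] by measurable
  have w_meas [measurable]: "w i \<in> borel_measurable borel" for i
    unfolding w_def[abs_def] by measurable
  have w_one: "(\<integral>\<^sup>+x. w i x \<partial>L) = 1" for i
    using one L1 by (cases "i \<le> m") (simp_all add: w_def)
  have rec_meas [measurable]: "received n A \<in> PiM {1..n} (\<lambda>_. borel) \<rightarrow>\<^sub>M ?P"
    unfolding rec by measurable
  have rec_meas': "received n A \<in> PiM {1..n} (\<lambda>_. density L r) \<rightarrow>\<^sub>M ?P"
    using rec_meas
    by (subst measurable_cong_sets[OF sets_PiM_cong[OF refl] refl]) (simp_all add: sets_L)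
  \<comment> \<open>The trivial weight 1 brings this side into the form of
    \<open>distr_density_PiM_coordinatewise\<close>, which is then used on both sides.\<close>
  have "distr (PiM {1..n} (\<lambda>_. density L r)) ?P (received n A)
    = distr (density (PiM {1..n} (\<lambda>_. density L r)) (\<lambda>y. \<Prod>i\<in>{1..n}. 1)) ?P (received n A)"
    by (simp add: density_1)
  also have "\<dots> = PiM {1..n} (\<lambda>i. distr (density (density L r) (\<lambda>_. 1)) borel (c i))"
    unfolding rec using D prob_space.emeasure_space_1[OF D]
    by (intro distr_density_PiM_coordinatewise) auto
  also have "\<dots> = PiM {1..n} (\<lambda>i. distr (density L (w i)) borel (c i))"
  proof (intro PiM_cong refl)
    fix i
    show "distr (density (density L r) (\<lambda>_. 1)) borel (c i) = distr (density L (w i)) borel (c i)"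
    proof (cases "i \<le> m")
      case True
      then have "w i = r" by (simp add: w_def fun_eq_iff)
      then show ?thesis by (simp add: density_1)
    next
      case False
      then have "w i = (\<lambda>_. 1)" "c i = (\<lambda>_. 0)" by (simp_all add: w_def c_def fun_eq_iff)
      then show ?thesis
        using prob_space.distr_const[OF D, of 0 borel] distr_const[of 0 borel]
        by (simp add: density_1)
    qed
  qed
  also have "\<dots> = distr (density R (lik r m)) ?P (received n A)"
    unfolding rec lik R_def
    by (intro distr_density_PiM_coordinatewise[symmetric] prob_space_axioms w_one) auto
  finally have law: "distr (PiM {1..n} (\<lambda>_. density L r)) ?P (received n A)
    = distr (density R (lik r m)) ?P (received n A)" .
  have "(\<integral>\<^sup>+y. g (received n A y) \<partial>PiM {1..n} (\<lambda>_. density L r))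
    = (\<integral>\<^sup>+z. g z \<partial>distr (PiM {1..n} (\<lambda>_. density L r)) ?P (received n A))"
    using g by (subst nn_integral_distr[OF rec_meas']) simp_all
  also have "\<dots> = (\<integral>\<^sup>+y. g (received n A y) \<partial>density R (lik r m))"
    unfolding law by (rule nn_integral_distr) measurable
  also have "\<dots> = (\<integral>\<^sup>+y. g (received n A y) * lik r (awake A) y \<partial>R)"
    by (subst nn_integral_density) (auto simp: m_def mult.commute)
  finally show ?thesis .
qed

end

section \<open>Law of the information\<close>

locale detection_model =
  D: detection L n p \<rho> lam_s lam_f r0 r1 + change_model M T X n p \<rho> f0 f1
  for L :: "real measure" and n p \<rho> lam_s lam_f r0 r1
    and M :: "'a measure" and T X f0 f1 +
  assumes n: "1 \<le> n"
    and dens: "density L r0 = density lborel (\<lambda>x. ennreal (f0 x))"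
      "density L r1 = density lborel (\<lambda>x. ennreal (f1 x))"
begin

definition T_prob :: "nat \<Rightarrow> real" where
  "T_prob t = prob {\<omega> \<in> space M. T \<omega> = t}"

text \<open>Prior probability of \<open>T = t\<close> times the likelihood of the received data for
  that value. The entry at \<open>k\<close> holds the observations of slot \<open>Suc k\<close>,
  hence the test \<open>Suc k < t\<close>.\<close>

primrec joint_at :: "nat \<Rightarrow> nat \<Rightarrow> info \<Rightarrow> ennreal" where
  "joint_at t 0 I = ennreal (T_prob t)"
| "joint_at t (Suc k) I =
    joint_at t k I * D.lik (if Suc k < t then r0 else r1) (awake (fst (I k))) (snd (I k))"

lemma T_set [measurable]: "{\<omega> \<in> space M. T \<omega> = t} \<in> events"
  using measurable_sets[OF T_measurable, of "{t}"] by (simp add: vimage_def Int_def conj_commute)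

lemma info_meas:
  assumes "admissible n \<mu>"
  shows "info n X \<mu> k \<in> M \<rightarrow>\<^sub>M info_space n k"
  using assms X_measurable by (intro info_measurable) auto

text \<open>Given \<open>T = t\<close> the observations are independent, so the one-step formula
  applies under \<open>uniform_measure\<close>. The model fixes no conditional law for values
  \<open>t\<close> of probability 0; there both sides vanish.\<close>

lemma nn_integral_info_Suc_at:
  assumes \<mu>: "admissible n \<mu>" and g: "g \<in> borel_measurable (info_space n (Suc k))"
  shows "(\<integral>\<^sup>+\<omega>. g (info n X \<mu> (Suc k) \<omega>) * indicator {\<omega> \<in> space M. T \<omega> = t} \<omega> \<partial>M)
    = (\<integral>\<^sup>+\<omega>. (\<integral>\<^sup>+y. g (D.extend \<mu> k (info n X \<mu> k \<omega>) y)
          * D.lik (if Suc k < t then r0 else r1) (awake (\<mu> k (info n X \<mu> k \<omega>))) y \<partial>D.R)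
        * indicator {\<omega> \<in> space M. T \<omega> = t} \<omega> \<partial>M)"
proof (cases "0 < T_prob t")
  case False
  then have "prob {\<omega> \<in> space M. T \<omega> = t} = 0"
    unfolding T_prob_def using zero_less_measure_iff by blast
  then have "emeasure M {\<omega> \<in> space M. T \<omega> = t} = 0"
    by (simp add: emeasure_eq_measure)
  then have "AE \<omega> in M. \<omega> \<notin> {\<omega> \<in> space M. T \<omega> = t}"
    by (intro AE_not_in null_setsI) auto
  then show ?thesis
    by (intro nn_integral_cong_AE) (auto split: split_indicator)
next
  case True
  define S where "S = {\<omega> \<in> space M. T \<omega> = t}"
  define r where "r = (if Suc k < t then r0 else r1)"
  define h where "h I = (\<integral>\<^sup>+y. g (D.extend \<mu> k I y) * D.lik r (awake (\<mu> k I)) y \<partial>D.R)" for I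
  let ?Q = "uniform_measure M S" and ?I = "info n X \<mu> k"
  have pos: "0 < prob {\<omega> \<in> space M. T \<omega> = t}" using True by (simp add: T_prob_def)
  have S: "S \<in> events" by (simp add: S_def)
  have eS: "emeasure M S \<noteq> 0" "emeasure M S \<noteq> \<infinity>"
    using pos by (auto simp: S_def emeasure_eq_measure)
  interpret Q: prob_space ?Q by (rule prob_space_uniform_measure[OF eS])
  have r: "r \<in> borel_measurable borel" "(\<integral>\<^sup>+x. r x \<partial>L) = 1"
    using D.r_int by (auto simp: r_def)
  have law: "distr ?Q borel (X (Suc k) i) = density L r" if i: "i \<in> {1..n}" for i
  proof -
    have "distr ?Q lborel (X (Suc k) i) = density lborel (\<lambda>x. ennreal (if Suc k < t then f0 x else f1 x))"
      using distributed_distr_eq_density[OF X_distributed[OF pos _ i, of "Suc k"]] by (simp add: S_def)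
    also have "\<dots> = density L r" by (simp add: r_def dens)
    also have "distr ?Q lborel (X (Suc k) i) = distr ?Q borel (X (Suc k) i)"
      by (intro distr_cong) auto
    finally show ?thesis .
  qed
  have "(\<integral>\<^sup>+\<omega>. g (info n X \<mu> (Suc k) \<omega>) \<partial>?Q)
    = (\<integral>\<^sup>+\<omega>. (\<integral>\<^sup>+y. g (D.extend \<mu> k (?I \<omega>) y) \<partial>PiM {1..n} (\<lambda>_. density L r)) \<partial>?Q)"
    using X_indep[OF pos] law g by (intro Q.nn_integral_info_Suc \<mu> n) (auto simp: S_def)
  also have "\<dots> = (\<integral>\<^sup>+\<omega>. h (?I \<omega>) \<partial>?Q)"
  proof (rule nn_integral_cong)
    fix \<omega> assume "\<omega> \<in> space ?Q"
    then have I: "?I \<omega> \<in> space (info_space n k)"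
      using measurable_space[OF info_meas[OF \<mu>]] by simp
    have "(\<lambda>z. (?I \<omega>)(k := (\<mu> k (?I \<omega>), z))) \<in> PiM {1..n} (\<lambda>_. borel) \<rightarrow>\<^sub>M info_space n (Suc k)"
      using I unfolding info_space_def
      by (intro measurable_fun_upd[where J = "{..<k}"] measurable_Pair measurable_const) auto
    from measurable_compose[OF this g]
    show "(\<integral>\<^sup>+y. g (D.extend \<mu> k (?I \<omega>) y) \<partial>PiM {1..n} (\<lambda>_. density L r)) = h (?I \<omega>)"
      unfolding h_def by (rule D.nn_integral_received_density[OF r])
  qed
  finally have eq: "(\<integral>\<^sup>+\<omega>. g (info n X \<mu> (Suc k) \<omega>) \<partial>?Q) = (\<integral>\<^sup>+\<omega>. h (?I \<omega>) \<partial>?Q)" .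
  have h_meas: "h \<in> borel_measurable (info_space n k)"
  proof -
    interpret R: sigma_finite_measure D.R by (rule D.sigma_finite_R)
    note D.sets_R [measurable_cong] r(1) [measurable]
    have [measurable]: "\<mu> k \<in> info_space n k \<rightarrow>\<^sub>M count_space UNIV"
      by (rule admissible_measurable[OF \<mu>])
    have [measurable]: "(\<lambda>(I, y). g (D.extend \<mu> k I y)) \<in> borel_measurable (info_space n k \<Otimes>\<^sub>M D.R)"
      using measurable_compose[OF D.extend_measurable[OF \<mu>] g] by (simp add: case_prod_beta)
    have "(\<lambda>z. D.lik r (awake (\<mu> k (fst z))) (snd z)) \<in> borel_measurable (info_space n k \<Otimes>\<^sub>M D.R)"
      by (rule D.lik_measurable_awake) measurable
    then have [measurable]: "(\<lambda>(I, y). D.lik r (awake (\<mu> k I)) y) \<in> borel_measurable (info_space n k \<Otimes>\<^sub>M D.R)"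
      by (simp add: case_prod_beta)
    show ?thesis unfolding h_def by measurable
  qed
  have cancel: "u = v" if "u / emeasure M S = v / emeasure M S" for u v :: ennreal
    using that eS by (metis ennreal_mult_divide_eq ennreal_divide_times infinity_ennreal_def mult.commute)
  have "(\<integral>\<^sup>+\<omega>. g (info n X \<mu> (Suc k) \<omega>) * indicator S \<omega> \<partial>M)
      = (\<integral>\<^sup>+\<omega>. h (?I \<omega>) * indicator S \<omega> \<partial>M)"
    using eq measurable_compose[OF info_meas[OF \<mu>] g] measurable_compose[OF info_meas[OF \<mu>] h_meas]
    by - (rule cancel, simp add: nn_integral_uniform_measure S)
  then show ?thesis by (simp add: h_def S_def r_def)
qed

lemma joint_at_upd: "k \<le> j \<Longrightarrow> joint_at t k (I(j := z)) = joint_at t k I"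
  by (induction k) auto

lemma joint_at_measurable:
  assumes "k \<le> K"
  shows "joint_at t k \<in> borel_measurable (info_space n K)"
  using assms
proof (induction k)
  case 0
  have "joint_at t 0 = (\<lambda>_. ennreal (T_prob t))" by (simp add: fun_eq_iff)
  then show ?case by simp
next
  case (Suc k)
  then have [measurable]: "joint_at t k \<in> borel_measurable (info_space n K)" by simp
  define r where "r = (if Suc k < t then r0 else r1)"
  have [measurable]: "r \<in> borel_measurable borel" by (simp add: r_def)
  have [measurable]: "(\<lambda>I. fst (I k)) \<in> info_space n K \<rightarrow>\<^sub>M count_space UNIV"
    "(\<lambda>I. snd (I k)) \<in> info_space n K \<rightarrow>\<^sub>M PiM {1..n} (\<lambda>_. borel)"
    using Suc.prems by (intro D.info_component_measurable; simp)+
  have "joint_at t (Suc k) = (\<lambda>I. joint_at t k I * D.lik r (awake (fst (I k))) (snd (I k)))"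
    by (simp add: fun_eq_iff r_def)
  then show ?case by simp
qed

text \<open>The induction ranges over all test functions: integrating out the last slot turns
  \<open>g\<close> into another function \<open>h\<close> of the earlier information, to which the
  hypothesis applies.\<close>

lemma nn_integral_info_at:
  assumes \<mu>: "admissible n \<mu>" and g: "g \<in> borel_measurable (info_space n k)"
  shows "(\<integral>\<^sup>+\<omega>. g (info n X \<mu> k \<omega>) * indicator {\<omega> \<in> space M. T \<omega> = t} \<omega> \<partial>M)
    = D.ref_integral \<mu> k (\<lambda>I. g I * joint_at t k I)"
  using g
proof (induction k arbitrary: g)
  case 0
  then show ?case
    by (simp add: nn_integral_cmult T_prob_def emeasure_eq_measure)
next
  case (Suc k)
  define r where "r = (if Suc k < t then r0 else r1)"
  define h where "h I = (\<integral>\<^sup>+y. g (D.extend \<mu> k I y) * D.lik r (awake (\<mu> k I)) y \<partial>D.R)" for I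
  have rm [measurable]: "r \<in> borel_measurable borel" by (simp add: r_def)
  \<comment> \<open>\<open>G\<close> reads the number of awake sensors from the information itself,
    which makes \<open>h\<close> an extension integral of a measurable function.\<close>
  define G where "G I = g I * D.lik r (awake (fst (I k))) (snd (I k))" for I
  have G: "G \<in> borel_measurable (info_space n (Suc k))"
  proof -
    have [measurable]: "(\<lambda>I. fst (I k)) \<in> info_space n (Suc k) \<rightarrow>\<^sub>M count_space UNIV"
      "(\<lambda>I. snd (I k)) \<in> info_space n (Suc k) \<rightarrow>\<^sub>M PiM {1..n} (\<lambda>_. borel)"
      by (intro D.info_component_measurable; simp)+
    note Suc.prems [measurable]
    show ?thesis unfolding G_def[abs_def] by measurable
  qed
  have hG: "h I = (\<integral>\<^sup>+y. G (D.extend \<mu> k I y) \<partial>D.R)" for I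
    unfolding h_def G_def by (simp add: D.lik_received)
  have h: "h \<in> borel_measurable (info_space n k)"
    unfolding hG[abs_def] by (rule D.extend_integral_measurable[OF \<mu> G])
  have "(\<integral>\<^sup>+\<omega>. g (info n X \<mu> (Suc k) \<omega>) * indicator {\<omega> \<in> space M. T \<omega> = t} \<omega> \<partial>M)
     = (\<integral>\<^sup>+\<omega>. h (info n X \<mu> k \<omega>) * indicator {\<omega> \<in> space M. T \<omega> = t} \<omega> \<partial>M)"
    unfolding h_def r_def by (rule nn_integral_info_Suc_at[OF \<mu> Suc.prems])
  also have "\<dots> = D.ref_integral \<mu> k (\<lambda>I. h I * joint_at t k I)"
    by (rule Suc.IH[OF h])
  also have "\<dots> = D.ref_integral \<mu> k (\<lambda>I. \<integral>\<^sup>+y. g (D.extend \<mu> k I y) * joint_at t (Suc k) (D.extend \<mu> k I y) \<partial>D.R)"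
  proof (rule D.ref_integral_cong[OF \<mu>])
    fix I assume I: "I \<in> space (info_space n k)"
    have "h I * joint_at t k I = (\<integral>\<^sup>+y. G (D.extend \<mu> k I y) * joint_at t k I \<partial>D.R)"
      unfolding hG by (rule nn_integral_multc[symmetric]) (rule D.extend_measurable_snd[OF \<mu> I G])
    also have "\<dots> = (\<integral>\<^sup>+y. g (D.extend \<mu> k I y) * joint_at t (Suc k) (D.extend \<mu> k I y) \<partial>D.R)"
      by (intro nn_integral_cong) (simp add: G_def joint_at_upd r_def mult_ac)
    finally show "h I * joint_at t k I = \<dots>" .
  qed
  finally show ?case by simp
qed

section \<open>Joint law of the information and the event that the change has occurred\<close>

primrec lik_unchanged :: "nat \<Rightarrow> info \<Rightarrow> ennreal" where
  "lik_unchanged 0 I = 1"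
| "lik_unchanged (Suc k) I = lik_unchanged k I * D.lik r0 (awake (fst (I k))) (snd (I k))"

lemma T_prob_simps: "T_prob 0 = \<rho>" "T_prob (Suc j) = (1 - \<rho>) * (1 - p) ^ j * p"
  using T_zero T_pos[of "Suc j"] by (simp_all add: T_prob_def)

text \<open>Up to slot \<open>k\<close> all data follow \<open>f0\<close> whatever the value of
  \<open>t > k\<close>, so these weights differ only in the prior factor.\<close>

lemma joint_at_future: "k < t \<Longrightarrow> joint_at t k I = ennreal (T_prob t) * lik_unchanged k I"
  by (induction k) (auto simp: mult.assoc)

lemma joint0_eq: "D.joint0 k I = ennreal ((1 - \<rho>) * (1 - p) ^ k) * lik_unchanged k I"
proof (induction k)
  case (Suc k)
  have "ennreal ((1 - \<rho>) * (1 - p) ^ Suc k) = ennreal (1 - p) * ennreal ((1 - \<rho>) * (1 - p) ^ k)"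
    using D.p D.rho by (simp add: ennreal_mult[symmetric] mult_ac)
  with Suc show ?case by (simp add: mult_ac)
qed simp

lemma joint1_eq: "D.joint1 k I = (\<Sum>t\<le>k. joint_at t k I)"
proof (induction k)
  case 0
  then show ?case by (simp add: T_prob_simps)
next
  case (Suc k)
  \<comment> \<open>The mass that passes from \<open>joint0\<close> to \<open>joint1\<close> is
    exactly the weight of a change in slot \<open>Suc k\<close>.\<close>
  have "ennreal p * D.joint0 k I = joint_at (Suc k) k I"
    using D.p D.rho by (simp add: joint0_eq joint_at_future T_prob_simps ennreal_mult mult_ac)
  then have "D.joint1 (Suc k) I
    = (\<Sum>t\<le>Suc k. joint_at t k I) * D.lik r1 (awake (fst (I k))) (snd (I k))"
    by (simp add: Suc)
  also have "\<dots> = (\<Sum>t\<le>Suc k. joint_at t (Suc k) I)"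
    unfolding sum_distrib_right by (intro sum.cong refl) simp
  finally show ?case .
qed

lemma lik_unchanged_measurable: "lik_unchanged k \<in> borel_measurable (info_space n k)"
proof -
  have "k \<le> K \<Longrightarrow> lik_unchanged k \<in> borel_measurable (info_space n K)" for K
  proof (induction k)
    case 0
    have "lik_unchanged 0 = (\<lambda>_. 1)" by (simp add: fun_eq_iff)
    then show ?case by simp
  next
    case (Suc k)
    then have [measurable]: "lik_unchanged k \<in> borel_measurable (info_space n K)" by simp
    have [measurable]: "(\<lambda>I. fst (I k)) \<in> info_space n K \<rightarrow>\<^sub>M count_space UNIV"
      "(\<lambda>I. snd (I k)) \<in> info_space n K \<rightarrow>\<^sub>M PiM {1..n} (\<lambda>_. borel)"
      using Suc.prems by (intro D.info_component_measurable; simp)+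
    have "lik_unchanged (Suc k) = (\<lambda>I. lik_unchanged k I * D.lik r0 (awake (fst (I k))) (snd (I k)))"
      by (simp add: fun_eq_iff)
    then show ?case by simp
  qed
  then show ?thesis by simp
qed

lemma nn_integral_info_changed:
  assumes \<mu>: "admissible n \<mu>" and g: "g \<in> borel_measurable (info_space n k)"
  shows "(\<integral>\<^sup>+\<omega>. g (info n X \<mu> k \<omega>) * indicator {\<omega> \<in> space M. T \<omega> \<le> k} \<omega> \<partial>M)
    = D.ref_integral \<mu> k (\<lambda>I. g I * D.joint1 k I)"
proof -
  have g': "(\<lambda>\<omega>. g (info n X \<mu> k \<omega>)) \<in> borel_measurable M"
    by (rule measurable_compose[OF info_meas[OF \<mu>] g])
  have m: "(\<lambda>I. g I * joint_at t k I) \<in> borel_measurable (info_space n k)" for t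
    using g joint_at_measurable[of k k t] by simp
  have ref_sum: "D.ref_integral \<mu> k (\<lambda>I. \<Sum>t\<in>F. g I * joint_at t k I)
    = (\<Sum>t\<in>F. D.ref_integral \<mu> k (\<lambda>I. g I * joint_at t k I))" if "finite F" for F
    using that
  proof (induction F)
    case empty
    have "D.ref_integral \<mu> k (\<lambda>I. 0 * 0) = 0 * D.ref_integral \<mu> k (\<lambda>I. 0)"
      by (rule D.ref_integral_cmult[OF \<mu>]) simp
    then show ?case by simp
  next
    case (insert t F)
    then show ?case
      using D.ref_integral_add[OF \<mu> m[of t] borel_measurable_sum[of F, OF m]] by simp
  qed
  have "(\<integral>\<^sup>+\<omega>. g (info n X \<mu> k \<omega>) * indicator {\<omega> \<in> space M. T \<omega> \<le> k} \<omega> \<partial>M)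
    = (\<integral>\<^sup>+\<omega>. (\<Sum>t\<le>k. g (info n X \<mu> k \<omega>) * indicator {\<omega> \<in> space M. T \<omega> = t} \<omega>) \<partial>M)"
    by (intro nn_integral_cong)
      (simp add: sum_distrib_left[symmetric] indicator_def sum.delta if_distrib[of of_bool] cong: if_cong)
  also have "\<dots> = (\<Sum>t\<le>k. \<integral>\<^sup>+\<omega>. g (info n X \<mu> k \<omega>) * indicator {\<omega> \<in> space M. T \<omega> = t} \<omega> \<partial>M)"
    using g' by (intro nn_integral_sum) simp
  also have "\<dots> = D.ref_integral \<mu> k (\<lambda>I. g I * D.joint1 k I)"
    unfolding joint1_eq sum_distrib_left by (simp add: nn_integral_info_at[OF \<mu> g] ref_sum)
  finally show ?thesis .
qed

lemma T_tail_sums: "(\<Sum>i. ennreal (T_prob (Suc k + i))) = ennreal ((1 - \<rho>) * (1 - p) ^ k)"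
proof -
  have "(\<lambda>i. (1 - \<rho>) * (1 - p) ^ k * p * (1 - p) ^ i) sums ((1 - \<rho>) * (1 - p) ^ k * p * (1 / (1 - (1 - p))))"
    using D.p by (intro sums_mult geometric_sums) auto
  then have "(\<lambda>i. T_prob (Suc k + i)) sums ((1 - \<rho>) * (1 - p) ^ k)"
    using D.p by (simp add: T_prob_simps power_add mult_ac)
  then show ?thesis
    by (intro suminf_ennreal_eq) (simp_all add: T_prob_def)
qed

text \<open>Infinitely many values of \<open>T\<close> contribute, but all with the common factor
  \<open>lik_unchanged k\<close>; only the geometric tail of the prior has to be summed.\<close>

lemma nn_integral_info_unchanged:
  assumes \<mu>: "admissible n \<mu>" and g: "g \<in> borel_measurable (info_space n k)"
  shows "(\<integral>\<^sup>+\<omega>. g (info n X \<mu> k \<omega>) * indicator {\<omega> \<in> space M. k < T \<omega>} \<omega> \<partial>M)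
    = D.ref_integral \<mu> k (\<lambda>I. g I * D.joint0 k I)"
proof -
  have g' [measurable]: "(\<lambda>\<omega>. g (info n X \<mu> k \<omega>)) \<in> borel_measurable M"
    by (rule measurable_compose[OF info_meas[OF \<mu>] g])
  have gl: "(\<lambda>I. g I * lik_unchanged k I) \<in> borel_measurable (info_space n k)"
    using g lik_unchanged_measurable by simp
  have split: "(indicator {\<omega> \<in> space M. k < T \<omega>} \<omega> :: ennreal)
      = (\<Sum>i. indicator {\<omega> \<in> space M. T \<omega> = Suc k + i} \<omega>)" if "\<omega> \<in> space M" for \<omega>
  proof (cases "k < T \<omega>")
    case True
    have "(\<Sum>i. indicator {\<omega> \<in> space M. T \<omega> = Suc k + i} \<omega> :: ennreal)
      = (\<Sum>i\<in>{T \<omega> - Suc k}. indicator {\<omega> \<in> space M. T \<omega> = Suc k + i} \<omega>)"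
      by (rule suminf_finite) (auto simp: indicator_def)
    then show ?thesis using True that by simp
  qed (auto simp: indicator_def)
  have "(\<integral>\<^sup>+\<omega>. g (info n X \<mu> k \<omega>) * indicator {\<omega> \<in> space M. k < T \<omega>} \<omega> \<partial>M)
    = (\<integral>\<^sup>+\<omega>. (\<Sum>i. g (info n X \<mu> k \<omega>) * indicator {\<omega> \<in> space M. T \<omega> = Suc k + i} \<omega>) \<partial>M)"
    by (intro nn_integral_cong) (simp add: split)
  also have "\<dots> = (\<Sum>i. \<integral>\<^sup>+\<omega>. g (info n X \<mu> k \<omega>) * indicator {\<omega> \<in> space M. T \<omega> = Suc k + i} \<omega> \<partial>M)"
    by (intro nn_integral_suminf) measurable
  also have "\<dots> = (\<Sum>i. ennreal (T_prob (Suc k + i)) * D.ref_integral \<mu> k (\<lambda>I. g I * lik_unchanged k I))"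
    by (simp add: nn_integral_info_at[OF \<mu> g] joint_at_future D.ref_integral_cmult[OF \<mu> gl, symmetric] mult_ac)
  also have "\<dots> = ennreal ((1 - \<rho>) * (1 - p) ^ k) * D.ref_integral \<mu> k (\<lambda>I. g I * lik_unchanged k I)"
    by (simp only: ennreal_suminf_multc T_tail_sums)
  also have "\<dots> = D.ref_integral \<mu> k (\<lambda>I. g I * D.joint0 k I)"
    by (simp add: D.ref_integral_cmult[OF \<mu> gl, symmetric] joint0_eq mult_ac)
  finally show ?thesis .
qed

lemma nn_integral_info:
  assumes \<mu>: "admissible n \<mu>" and g: "g \<in> borel_measurable (info_space n k)"
  shows "(\<integral>\<^sup>+\<omega>. g (info n X \<mu> k \<omega>) \<partial>M)
    = D.ref_integral \<mu> k (\<lambda>I. g I * (D.joint1 k I + D.joint0 k I))"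
proof -
  have g' [measurable]: "(\<lambda>\<omega>. g (info n X \<mu> k \<omega>)) \<in> borel_measurable M"
    by (rule measurable_compose[OF info_meas[OF \<mu>] g])
  note T_measurable [measurable]
  have "(\<integral>\<^sup>+\<omega>. g (info n X \<mu> k \<omega>) \<partial>M)
    = (\<integral>\<^sup>+\<omega>. g (info n X \<mu> k \<omega>) * indicator {\<omega> \<in> space M. T \<omega> \<le> k} \<omega>
        + g (info n X \<mu> k \<omega>) * indicator {\<omega> \<in> space M. k < T \<omega>} \<omega> \<partial>M)"
    by (intro nn_integral_cong) (auto simp: indicator_def)
  also have "\<dots> = D.ref_integral \<mu> k (\<lambda>I. g I * D.joint1 k I) + D.ref_integral \<mu> k (\<lambda>I. g I * D.joint0 k I)"
    by (subst nn_integral_add)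
      (simp_all add: nn_integral_info_changed[OF \<mu> g] nn_integral_info_unchanged[OF \<mu> g])
  also have "\<dots> = D.ref_integral \<mu> k (\<lambda>I. g I * (D.joint1 k I + D.joint0 k I))"
    using g by (subst D.ref_integral_add[OF \<mu>, symmetric]) (simp_all add: distrib_left)
  finally show ?thesis .
qed

section \<open>Identification of the posterior\<close>

lemma ennreal_filter_prob:
  "ennreal (D.filter_prob k I) * (D.joint1 k I + D.joint0 k I) = D.joint1 k I"
  "ennreal (1 - D.filter_prob k I) * (D.joint1 k I + D.joint0 k I) = D.joint0 k I"
  "0 \<le> D.filter_prob k I" "D.filter_prob k I \<le> 1"
proof -
  obtain x y where xy: "D.joint1 k I = ennreal x" "D.joint0 k I = ennreal y" "0 \<le> x" "0 \<le> y"
    using D.joint_finite[of k I] by (metis ennreal_cases less_top)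
  \<comment> \<open>If both weights vanish, \<open>0 / 0 = 0\<close> in \<open>ennreal\<close> as
    well as in \<open>real\<close>, so the formula holds without a positivity assumption.\<close>
  have *: "D.filter_prob k I = x / (x + y)"
  proof (cases "x + y = 0")
    case True
    then have "x = 0" "y = 0" using xy(3,4) by auto
    then show ?thesis using xy by (simp add: D.filter_prob_def)
  next
    case False
    then show ?thesis
      using xy by (simp add: D.filter_prob_def divide_ennreal flip: ennreal_plus)
  qed
  show "0 \<le> D.filter_prob k I" "D.filter_prob k I \<le> 1"
    using xy by (auto simp: * divide_le_eq_1)
  have weights: "x / (x + y) * (x + y) = x" "(1 - x / (x + y)) * (x + y) = y"
  proof -
    show *: "x / (x + y) * (x + y) = x"
      using xy(3,4) by (cases "x + y = 0") auto
    show "(1 - x / (x + y)) * (x + y) = y"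
      unfolding left_diff_distrib * by simp
  qed
  have sum: "D.joint1 k I + D.joint0 k I = ennreal (x + y)"
    using xy by simp
  have "x / (x + y) \<le> 1" using xy(3,4) by (cases "x + y = 0") (auto simp: divide_le_eq_1)
  then have "ennreal (x / (x + y)) * ennreal (x + y) = ennreal x"
    "ennreal (1 - x / (x + y)) * ennreal (x + y) = ennreal y"
    using xy(3,4) by (simp_all add: weights del: ennreal_plus flip: ennreal_mult)
  then show "ennreal (D.filter_prob k I) * (D.joint1 k I + D.joint0 k I) = D.joint1 k I"
    and "ennreal (1 - D.filter_prob k I) * (D.joint1 k I + D.joint0 k I) = D.joint0 k I"
    unfolding * sum unfolding xy .
qed

text \<open>The defining property of conditional expectation is checked on events of the form that
  the information lies in \<open>B\<close>: the total density times \<open>filter_prob\<close> is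
  \<open>joint1\<close>, so both integrals are the same reference integral.\<close>

lemma posterior_eq_filter_prob:
  assumes \<mu>: "admissible n \<mu>"
  shows "AE \<omega> in M. posterior M T n X \<mu> k \<omega> = D.filter_prob k (info n X \<mu> k \<omega>)"
proof -
  let ?I = "info n X \<mu> k" and ?F = "info_algebra M n X \<mu> k"
  let ?A = "{\<omega> \<in> space M. T \<omega> \<le> k}"
  have I: "?I \<in> M \<rightarrow>\<^sub>M info_space n k" by (rule info_meas[OF \<mu>])
  then have I_space: "?I \<in> space M \<rightarrow> space (info_space n k)" by (auto dest: measurable_space)
  have A [measurable]: "?A \<in> events"
    using measurable_sets[OF T_measurable, of "{..k}"] by (simp add: vimage_def Int_def conj_commute)
  have sets_F: "sets ?F = {?I -` B \<inter> space M |B. B \<in> sets (info_space n k)}"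
    unfolding info_algebra_def by (rule sets_vimage_algebra2[OF I_space])
  have sub: "subalgebra M ?F"
    by (auto simp: subalgebra_def sets_F intro: measurable_sets[OF I]) (simp_all add: info_algebra_def)
  interpret F: finite_measure_subalgebra M ?F
    by unfold_locales (rule sub)
  have filter_F: "(\<lambda>\<omega>. D.filter_prob k (?I \<omega>)) \<in> borel_measurable ?F"
    unfolding info_algebra_def
    by (rule measurable_compose[OF measurable_vimage_algebra1[OF I_space] D.filter_prob_measurable])
  have filter_M [measurable]: "(\<lambda>\<omega>. D.filter_prob k (?I \<omega>)) \<in> borel_measurable M"
    by (rule measurable_compose[OF I D.filter_prob_measurable])
  show ?thesis
    unfolding posterior_def
  proof (rule F.real_cond_exp_charact)
    fix S assume "S \<in> sets ?F"
    then obtain B where B: "B \<in> sets (info_space n k)" and S: "S = ?I -` B \<inter> space M"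
      unfolding sets_F by auto
    have S_ev [measurable]: "S \<in> events" unfolding S by (rule measurable_sets[OF I B])
    have "(\<integral>\<^sup>+\<omega>. ennreal (indicator S \<omega> * indicator ?A \<omega>) \<partial>M)
      = (\<integral>\<^sup>+\<omega>. indicator B (?I \<omega>) * indicator ?A \<omega> \<partial>M)"
      by (intro nn_integral_cong) (auto simp: S indicator_def)
    also have "\<dots> = D.ref_integral \<mu> k (\<lambda>I. indicator B I * D.joint1 k I)"
      using B by (intro nn_integral_info_changed \<mu>) simp
    also have "\<dots> = D.ref_integral \<mu> k
        (\<lambda>I. (indicator B I * ennreal (D.filter_prob k I)) * (D.joint1 k I + D.joint0 k I))"
      by (simp only: mult.assoc ennreal_filter_prob)
    also have "\<dots> = (\<integral>\<^sup>+\<omega>. indicator B (?I \<omega>) * ennreal (D.filter_prob k (?I \<omega>)) \<partial>M)"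
      using B D.filter_prob_measurable by (intro nn_integral_info[symmetric] \<mu>) simp
    also have "\<dots> = (\<integral>\<^sup>+\<omega>. ennreal (indicator S \<omega> * D.filter_prob k (?I \<omega>)) \<partial>M)"
      by (intro nn_integral_cong) (auto simp: S indicator_def)
    finally show "(\<integral>\<omega>\<in>S. indicator ?A \<omega> \<partial>M) = (\<integral>\<omega>\<in>S. D.filter_prob k (?I \<omega>) \<partial>M)"
      unfolding set_lebesgue_integral_def
      by (subst (1 2) integral_eq_nn_integral) (simp_all add: ennreal_filter_prob)
  next
    show "integrable M (indicator ?A :: _ \<Rightarrow> real)"
      by (intro integrable_real_indicator A) (simp add: emeasure_eq_measure)
    show "integrable M (\<lambda>\<omega>. D.filter_prob k (?I \<omega>))"
      by (rule integrable_const_bound[where B = 1]) (simp_all add: ennreal_filter_prob)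
  qed (rule filter_F)
qed

section \<open>Expected cost as a series of reference integrals\<close>

lemma info_action:
  assumes "j < k"
  shows "fst (info n X \<mu> k \<omega> j) = action_taken n X \<mu> j \<omega>"
  using assms
proof (induction k)
  case (Suc k)
  then show ?case
    by (cases "j = k") (simp_all only: info_Suc action_taken_def fun_upd_apply fst_conv, auto simp: action_taken_def)
qed simp

lemma alive_info: "D.alive k (info n X \<mu> k \<omega>) \<longleftrightarrow> (\<forall>j<k. action_taken n X \<mu> j \<omega> \<noteq> Stop)"
  by (auto simp: D.alive_def info_action)

text \<open>The posterior is a free argument \<open>x\<close>: the pointwise path cost inserts
  \<open>posterior\<close>, and almost surely this may be replaced by \<open>filter_prob\<close>,
  which is a function of the information.\<close>

definition slot_cost :: "policy \<Rightarrow> nat \<Rightarrow> real \<Rightarrow> info \<Rightarrow> ennreal" where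
  "slot_cost \<mu> k x I =
    (if \<not> D.alive k I then 0
     else if \<mu> k I = Stop then ennreal (lam_f * (1 - x))
     else ennreal (x + lam_s * real (awake (\<mu> k I))))"

text \<open>Slots after the first alarm are charged 0, so finite and infinite stopping slots merge
  into one series over all slots.\<close>

lemma path_cost_eq:
  "path_cost M T n X lam_s lam_f \<mu> \<omega>
    = (\<Sum>k. slot_cost \<mu> k (posterior M T n X \<mu> k \<omega>) (info n X \<mu> k \<omega>))"
proof (cases "\<exists>k. action_taken n X \<mu> k \<omega> = Stop")
  case False
  then have "{enat k |k. action_taken n X \<mu> k \<omega> = Stop} = {}" by auto
  then have "stopping_slot n X \<mu> \<omega> = \<infinity>"
    unfolding stopping_slot_def by (simp only: Inf_enat_def) simp
  then show ?thesis
    using False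
    by (simp add: path_cost_def running_cost_def slot_cost_def alive_info) (simp add: action_taken_def)
next
  case True
  define N where "N = (LEAST k. action_taken n X \<mu> k \<omega> = Stop)"
  let ?c = "\<lambda>k. slot_cost \<mu> k (posterior M T n X \<mu> k \<omega>) (info n X \<mu> k \<omega>)"
  have N: "action_taken n X \<mu> N \<omega> = Stop" unfolding N_def using True by (rule LeastI_ex)
  have less: "action_taken n X \<mu> k \<omega> \<noteq> Stop" if "k < N" for k
    using that unfolding N_def by (rule not_less_Least)
  have "stopping_slot n X \<mu> \<omega> = enat N"
    unfolding stopping_slot_def
  proof (rule antisym)
    show "Inf {enat k |k. action_taken n X \<mu> k \<omega> = Stop} \<le> enat N"
      using N by (intro Inf_lower) auto
    show "enat N \<le> Inf {enat k |k. action_taken n X \<mu> k \<omega> = Stop}"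
      using less by (intro Inf_greatest) (auto simp flip: not_less)
  qed
  then have "path_cost M T n X lam_s lam_f \<mu> \<omega>
    = ennreal (lam_f * (1 - posterior M T n X \<mu> N \<omega>)) + (\<Sum>k<N. running_cost M T n X lam_s \<mu> k \<omega>)"
    by (simp add: path_cost_def)
  also have "(\<Sum>k<N. running_cost M T n X lam_s \<mu> k \<omega>) = (\<Sum>k<N. ?c k)"
  proof (intro sum.cong refl)
    fix k assume "k \<in> {..<N}"
    then have "D.alive k (info n X \<mu> k \<omega>)" "\<mu> k (info n X \<mu> k \<omega>) \<noteq> Stop"
      using less by (auto simp: alive_info action_taken_def)
    then show "running_cost M T n X lam_s \<mu> k \<omega> = ?c k"
      by (simp add: running_cost_def slot_cost_def action_taken_def)
  qed
  also have "ennreal (lam_f * (1 - posterior M T n X \<mu> N \<omega>)) = ?c N"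
    using N less by (auto simp: slot_cost_def alive_info) (simp_all add: action_taken_def)
  also have "?c N + (\<Sum>k<N. ?c k) = (\<Sum>k<Suc N. ?c k)"
    by (simp add: add.commute)
  also have "\<dots> = (\<Sum>k. ?c k)"
  proof (intro suminf_finite[symmetric])
    fix k assume "k \<notin> {..<Suc N}"
    then have "\<not> D.alive k (info n X \<mu> k \<omega>)" using N by (auto simp: alive_info not_less Suc_le_eq)
    then show "?c k = 0" by (simp add: slot_cost_def)
  qed simp
  finally show ?thesis .
qed

text \<open>Series and expectation commute because all terms lie in \<open>ennreal\<close>;
  multiplying a slot cost by the total density then gives \<open>stage_cost\<close>.\<close>

lemma expected_cost_eq:
  assumes \<mu>: "admissible n \<mu>"
  shows "expected_cost M T n X lam_s lam_f \<mu> = (\<Sum>k. D.ref_integral \<mu> k (D.stage_cost \<mu> k))"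
proof -
  let ?c = "\<lambda>k I. slot_cost \<mu> k (D.filter_prob k I) I"
  have c: "?c k \<in> borel_measurable (info_space n k)" for k
  proof -
    note D.alive_measurable [measurable] D.filter_prob_measurable [measurable]
    have [measurable]: "\<mu> k \<in> info_space n k \<rightarrow>\<^sub>M count_space UNIV"
      by (rule admissible_measurable[OF \<mu>])
    show ?thesis unfolding slot_cost_def by measurable
  qed
  have stage: "?c k I * (D.joint1 k I + D.joint0 k I) = D.stage_cost \<mu> k I" for k I
  proof -
    note fp = ennreal_filter_prob[of k I]
    have "ennreal (lam_f * (1 - D.filter_prob k I)) * (D.joint1 k I + D.joint0 k I)
      = ennreal lam_f * D.joint0 k I"
      using D.lam fp(3,4) by (simp add: ennreal_mult mult.assoc fp(2))
    moreover have "ennreal (D.filter_prob k I + lam_s * real m) * (D.joint1 k I + D.joint0 k I)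
      = D.joint1 k I + ennreal lam_s * of_nat m * (D.joint1 k I + D.joint0 k I)" for m
      using D.lam fp(3) by (simp add: ennreal_mult distrib_right fp(1) ennreal_of_nat_eq_real_of_nat)
    ultimately show ?thesis
      by (simp add: slot_cost_def D.stage_cost_def)
  qed
  have "AE \<omega> in M. \<forall>k. posterior M T n X \<mu> k \<omega> = D.filter_prob k (info n X \<mu> k \<omega>)"
    by (simp add: AE_all_countable posterior_eq_filter_prob[OF \<mu>])
  then have "expected_cost M T n X lam_s lam_f \<mu> = (\<integral>\<^sup>+\<omega>. (\<Sum>k. ?c k (info n X \<mu> k \<omega>)) \<partial>M)"
    unfolding expected_cost_def path_cost_eq by (intro nn_integral_cong_AE) auto
  also have "\<dots> = (\<Sum>k. \<integral>\<^sup>+\<omega>. ?c k (info n X \<mu> k \<omega>) \<partial>M)"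
    by (intro nn_integral_suminf measurable_compose[OF info_meas[OF \<mu>] c])
  also have "\<dots> = (\<Sum>k. D.ref_integral \<mu> k (D.stage_cost \<mu> k))"
    by (simp only: nn_integral_info[OF \<mu> c] stage)
  finally show ?thesis .
qed

lemma threshold_policy_optimal:
  "is_arg_min (expected_cost M T n X lam_s lam_f) (admissible n) D.threshold_policy"
proof -
  have "expected_cost M T n X lam_s lam_f D.threshold_policy \<le> expected_cost M T n X lam_s lam_f \<mu>"
    if "admissible n \<mu>" for \<mu>
    using that D.total_cost_threshold_policy D.W_le_total_cost[OF that] D.threshold_policy_admissible
    by (simp add: expected_cost_eq)
  then show ?thesis
    by (auto simp: is_arg_min_def D.threshold_policy_admissible not_less)
qed

text \<open>The policy compares \<open>filter_prob\<close> with the threshold, and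
  \<open>posterior\<close>, being a version of a conditional expectation, agrees with it only almost
  surely.\<close>

lemma threshold_policy_stopping_slot:
  "AE \<omega> in M. stopping_slot n X D.threshold_policy \<omega>
     = Inf {enat k |k. D.threshold \<le> posterior M T n X D.threshold_policy k \<omega>}"
proof -
  have stop_iff: "D.threshold_policy k I = Stop \<longleftrightarrow> D.threshold \<le> D.filter_prob k I" for k I
    by (simp add: D.threshold_policy_def)
  have "AE \<omega> in M. \<forall>k. posterior M T n X D.threshold_policy k \<omega>
      = D.filter_prob k (info n X D.threshold_policy k \<omega>)"
    by (simp add: AE_all_countable posterior_eq_filter_prob D.threshold_policy_admissible)
  then show ?thesis
    by eventually_elim (simp add: stopping_slot_def action_taken_def stop_iff)
qed

end

section \<open>Choice of the reference law and conclusion\<close>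

theorem theorem2:
  fixes n :: nat and p \<rho> lam_s lam_f :: real and f0 f1 :: "real \<Rightarrow> real"
  assumes "1 \<le> n"
    and "0 < p" "p \<le> 1"
    and "0 \<le> \<rho>" "\<rho> \<le> 1"
    and "0 \<le> lam_s" "0 \<le> lam_f"
    and "prob_density_fun f0" "prob_density_fun f1" "f0 \<noteq> f1"
  shows "\<exists>\<Gamma>\<in>{0..1}. \<forall>(M :: 'a measure) T X. change_model M T X n p \<rho> f0 f1 \<longrightarrow>
    (\<exists>\<mu>. is_arg_min (expected_cost M T n X lam_s lam_f) (admissible n) \<mu> \<and>
      (AE \<omega> in M. stopping_slot n X \<mu> \<omega> = Inf {enat k | k. \<Gamma> \<le> posterior M T n X \<mu> k \<omega>}))"
proof -
  \<comment> \<open>The mixture dominates both laws even when their supports are disjoint. Where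
    \<open>f0 x + f1 x = 0\<close>, both densities vanish and the value 0 of \<open>ratio\<close>
    does no harm.\<close>
  define L where "L = density lborel (\<lambda>x. ennreal ((f0 x + f1 x) / 2))"
  define ratio where "ratio f x = ennreal (2 * f x / (f0 x + f1 x))" for f :: "real \<Rightarrow> real" and x
  have f: "f0 \<in> borel_measurable borel" "f1 \<in> borel_measurable borel" "0 \<le> f0 x" "0 \<le> f1 x"
    "(\<integral>\<^sup>+x. ennreal (f0 x) \<partial>lborel) = 1" "(\<integral>\<^sup>+x. ennreal (f1 x) \<partial>lborel) = 1" for x
    using assms(8,9) by (auto simp: prob_density_fun_def)
  note f(1,2) [measurable]
  have ratio_meas [measurable]: "ratio f0 \<in> borel_measurable borel" "ratio f1 \<in> borel_measurable borel"
    unfolding ratio_def[abs_def] by measurable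
  have "(\<integral>\<^sup>+x. ennreal ((f0 x + f1 x) / 2) \<partial>lborel)
    = (\<integral>\<^sup>+x. ennreal (1/2) * (ennreal (f0 x) + ennreal (f1 x)) \<partial>lborel)"
  proof (rule nn_integral_cong)
    fix x
    have "ennreal ((f0 x + f1 x) / 2) = ennreal (1/2 * (f0 x + f1 x))" by simp
    also have "\<dots> = ennreal (1/2) * (ennreal (f0 x) + ennreal (f1 x))"
      using f(3,4)[of x] by (subst ennreal_mult) simp_all
    finally show "ennreal ((f0 x + f1 x) / 2) = \<dots>" .
  qed
  also have "\<dots> = ennreal (1/2) * (1 + 1)"
    using f(5,6) by (simp add: nn_integral_cmult nn_integral_add)
  also have "\<dots> = 1"
  proof -
    have "ennreal (1/2) * (1 + 1) = ennreal (1/2) * ennreal 2" by simp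
    also have "\<dots> = 1" by (subst ennreal_mult[symmetric]) simp_all
    finally show ?thesis .
  qed
  finally have "prob_space L"
    unfolding L_def by (intro prob_spaceI) (simp add: emeasure_density cong: nn_integral_cong)
  have mult: "ennreal ((f0 x + f1 x) / 2) * ratio f x = ennreal (f x)" if "f = f0 \<or> f = f1" for f x
    using f(3,4)[of x] that
    by (auto simp: ratio_def ennreal_mult[symmetric] add_nonneg_eq_0_iff)
  have dens: "density L (ratio f) = density lborel (\<lambda>x. ennreal (f x))" if "f = f0 \<or> f = f1" for f
    unfolding L_def using that f(1,2) ratio_meas
    by (subst density_density_eq) (auto simp: mult)
  have ratio_int: "(\<integral>\<^sup>+x. ratio f x \<partial>L) = 1" if "f = f0 \<or> f = f1" for f
    unfolding L_def using that f ratio_meas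
    by (subst nn_integral_density) (auto simp: mult)
  have ratio_finite: "ratio f x < \<top>" for f x by (simp add: ratio_def)
  have sets_L: "sets L = sets borel" by (simp add: L_def)
  \<comment> \<open>Only densities and parameters enter here, so the threshold is fixed before any
    probability space carrying the model is chosen.\<close>
  interpret detection L n p \<rho> lam_s lam_f "ratio f0" "ratio f1"
    using assms \<open>prob_space L\<close>
    by (intro detection.intro detection_axioms.intro) (auto simp: ratio_int ratio_finite sets_L)
  show ?thesis
  proof (intro bexI[of _ threshold] allI impI)
    show "threshold \<in> {0..1}" using threshold_bounds by simp
    fix M :: "'a measure" and T X
    assume model: "change_model M T X n p \<rho> f0 f1"
    interpret model: detection_model L n p \<rho> lam_s lam_f "ratio f0" "ratio f1" M T X f0 f1
      using assms(1) dens
      by (intro detection_model.intro detection_model_axioms.intro detection_axioms model) auto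
    show "\<exists>\<mu>. is_arg_min (expected_cost M T n X lam_s lam_f) (admissible n) \<mu> \<and>
      (AE \<omega> in M. stopping_slot n X \<mu> \<omega> = Inf {enat k | k. threshold \<le> posterior M T n X \<mu> k \<omega>})"
      using model.threshold_policy_optimal model.threshold_policy_stopping_slot by blast
  qed
qed

end
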